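(* Let $n\ge 3$ be an integer and let $X_1,X_2,\ldots,X_n$ be independent, identically distributed positive random variables whose common distribution $F$ has a density $f$ that is positive and continuous on $(0,\infty)$. Let $X_{(1)}\le X_{(2)}\le\cdots\le X_{(n)}$ be the order statistics and $\overline{X}_n=\frac1n\sum_{i=1}^n X_i$ the sample mean. Let $p>0$, $q>0$ and $a_{ij}\ge 0$ $(i,j=1,\ldots,n)$ be real numbers with $a_{11}>0$ and $a_{nn}>0$. Define $$Z_n=\sum_{i=1}^n\sum_{j=1}^n a_{ij}\,\big|X_{(i)}-\overline{X}_n\big|^p\,\big|X_{(j)}-\overline{X}_n\big|^q.$$ Then $\overline{X}_n$ and $(Z_n)^{1/(p+q)}/\overline{X}_n$ are independent if and only if $F$ is a gamma distribution.
   Context: A distribution $F$ is a gamma distribution if, for some $a>0$ and $b>0$, it is absolutely continuous with density $\frac{1}{\Gamma(a)b^a}x^{a-1}e^{-x/b}$ for $x>0$ and $0$ for $x\le 0$. *)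

theory Defs
  imports "HOL-Probability.Probability"
begin

definition gamma_density :: "real \<Rightarrow> real \<Rightarrow> real \<Rightarrow> real" where
  "gamma_density a b x =
     (if 0 < x then 1 / (Gamma a * b powr a) * x powr (a - 1) * exp (- x / b) else 0)"

definition gamma_distribution :: "real measure \<Rightarrow> bool" where
  "gamma_distribution F \<longleftrightarrow>
     (\<exists>a>0. \<exists>b>0. F = density lborel (\<lambda>x. ennreal (gamma_density a b x)))"

(* Samples are indexed by {1..n}: order_stat n x k is the k-th smallest of x 1, ..., x n,
   counted with multiplicity, and is meaningful only for k in {1..n}. *)

definition order_stat :: "nat \<Rightarrow> (nat \<Rightarrow> real) \<Rightarrow> nat \<Rightarrow> real" where
  "order_stat n x k = sort (map x [1..<Suc n]) ! (k - 1)"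

definition sample_mean :: "nat \<Rightarrow> (nat \<Rightarrow> real) \<Rightarrow> real" where
  "sample_mean n x = (\<Sum>i=1..n. x i) / real n"

definition Z_stat ::
    "nat \<Rightarrow> (nat \<Rightarrow> nat \<Rightarrow> real) \<Rightarrow> real \<Rightarrow> real \<Rightarrow> (nat \<Rightarrow> real) \<Rightarrow> real" where
  "Z_stat n a p q x =
     (\<Sum>i=1..n. \<Sum>j=1..n. a i j * \<bar>order_stat n x i - sample_mean n x\<bar> powr p
                               * \<bar>order_stat n x j - sample_mean n x\<bar> powr q)"

end

theory Submission
  imports Defs
begin

text \<open>
  The sample mean \<open>m\<close> and the ratio \<open>W = Z\<^sub>n powr (1 / (p + q)) / m\<close> are the radius and a function
  of the direction in polar coordinates on the positive orthant: \<open>W\<close> is homogeneous of degree 0.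
  Writing a positive point as \<open>s * z\<close>, with mean \<open>s\<close> and with \<open>z\<close> in the simplex of positive
  vectors of mean 1, turns Lebesgue measure into \<open>n * s ^ (n - 1) ds d\<sigma>(z)\<close>, where \<open>\<sigma>\<close> is the cone
  measure (polar_coordinates). In these coordinates the joint density of the sample is the
  product of the \<open>f (s * z\<^sub>i)\<close>.

  If \<open>f x = exp (A + l * x) * x powr k\<close>, this product is \<open>f s ^ n\<close> times the \<open>k\<close>-th power of the product
  of the \<open>z\<^sub>i\<close>, because the \<open>z\<^sub>i\<close> sum to \<open>n\<close>. Radius and direction then separate, and any function
  of the direction is independent of the mean (indep_if_power_exp). Gamma densities have this form.

  Conversely, let \<open>B \<epsilon>\<close> be the part of the simplex where \<open>W \<le> \<epsilon>\<close>, and let \<open>E(\<epsilon>, s)\<close> be the integral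
  over \<open>B \<epsilon>\<close> of the product of the \<open>f (s * z\<^sub>i)\<close>. Independence makes \<open>E(\<epsilon>, s) / E(\<epsilon>', s)\<close>
  the same for all \<open>s\<close>. The weights \<open>a 1 1\<close> and \<open>a n n\<close> being positive, \<open>W\<close> controls the distance of
  all coordinates to the mean, so \<open>B \<epsilon>'\<close> shrinks to the centre as \<open>\<epsilon>'\<close> tends to 0 and \<open>E(\<epsilon>', s)\<close> is
  asymptotically \<open>f s ^ n\<close> times the mass of \<open>B \<epsilon>'\<close>. Hence \<open>E(\<epsilon>, s) = h \<epsilon> * f s ^ n\<close>
  (cap_mean_factorises).

  This identity determines \<open>f\<close>. For a smooth \<open>f\<close> a second order expansion in \<open>\<epsilon>\<close> would show that
  \<open>s\<^sup>2 (ln f)''\<close> is constant. For a merely continuous \<open>f\<close> one compares with the exact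
  solutions \<open>C * exp (l * x) * x powr k\<close>, as in the theory of viscosity solutions. If
  \<open>ln f - k ln\<close> lies above one of its chords at an interior point, some
  \<open>exp (A + l * x) * x powr k\<close> touches \<open>f\<close> from above at some \<open>s\<close>, and the identity at \<open>s\<close> gives
  \<open>h \<epsilon> \<le> H k \<epsilon>\<close> for small \<open>\<epsilon>\<close>, where \<open>H k \<epsilon>\<close> is the integral over \<open>B \<epsilon>\<close> of the \<open>k\<close>-th power of the
  product of the \<open>z\<^sub>i\<close> (cap_mean_le_power_mean). If it lies below a chord, \<open>h \<epsilon> \<ge> H k \<epsilon>\<close>
  (power_mean_le_cap_mean). By the inequality of arithmetic and geometric means \<open>H k \<epsilon>\<close> is strictly
  decreasing in \<open>k\<close>, so the exponent for which \<open>ln f - k ln\<close> meets a chord at a third point cannot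
  depend on the chord. For that exponent \<open>ln f - k ln\<close> is affine (power_exp_if_cap_mean_factorises),
  and integrability leaves only gamma densities (gamma_distribution_if_power_exp).
\<close>

section \<open>Chords and tangents\<close>

text \<open>
  The line is parallel to the chord: subtracting it from \<open>g\<close> makes the two endpoint values equal, so the
  maximum is attained in the interior. This replaces a bound on the second derivative.
\<close>

lemma tangent_from_above:
  fixes g :: "real \<Rightarrow> real"
  assumes "a < m" "m < b" and cont: "continuous_on {a..b} g"
    and above: "(b - m) * g a + (m - a) * g b < (b - a) * g m"
  obtains x0 l where "a < x0" "x0 < b" "\<And>x. x \<in> {a..b} \<Longrightarrow> g x \<le> g x0 + l * (x - x0)"
proof -
  define l where "l = (g b - g a) / (b - a)"
  define w where "w x = g x - l * x" for x
  have l: "l * (b - a) = g b - g a"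
    using assms(1,2) by (simp add: l_def)
  have "continuous_on {a..b} w"
    unfolding w_def by (intro continuous_intros cont)
  then obtain x0 where x0: "x0 \<in> {a..b}" "\<And>x. x \<in> {a..b} \<Longrightarrow> w x \<le> w x0"
    using continuous_attains_sup[of "{a..b}" w] assms(1,2) by fastforce
  have ab: "w a = w b"
    using l by (simp add: w_def algebra_simps)
  have "(b - a) * w a = (b - m) * w a + (m - a) * w b"
    using ab by (simp add: algebra_simps)
  also have "\<dots> < (b - a) * w m"
    using above by (simp add: w_def algebra_simps)
  finally have "w a < w m"
    using assms(1,2) by simp
  with x0(2)[of m] ab assms(1,2) have "x0 \<noteq> a" "x0 \<noteq> b"
    by auto
  with x0(1) have "a < x0" "x0 < b"
    by auto
  moreover have "g x \<le> g x0 + l * (x - x0)" if "x \<in> {a..b}" for x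
    using x0(2)[OF that] by (simp add: w_def algebra_simps)
  ultimately show thesis
    using that by blast
qed

text \<open>
  Height of the graph of \<open>g\<close> above its chord over \<open>[a, b]\<close> at the point \<open>m\<close>, multiplied by the
  positive number \<open>b - a\<close> to avoid division.
\<close>

definition chord_gap :: "(real \<Rightarrow> real) \<Rightarrow> real \<Rightarrow> real \<Rightarrow> real \<Rightarrow> real" where
  "chord_gap g a m b = (b - a) * g m - (b - m) * g a - (m - a) * g b"

lemma chord_gap_add_cmult:
  "chord_gap (\<lambda>x. g x + c * h x) a m b = chord_gap g a m b + c * chord_gap h a m b"
  by (simp add: chord_gap_def algebra_simps)

lemma ln_less_tangent:
  fixes x m :: real
  assumes "0 < x" "0 < m" "x \<noteq> m"
  shows "ln x < ln m + (x - m) / m"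
proof -
  have "ln (x / m) < x / m - 1"
    using ln_eq_minus_one[of "x / m"] ln_le_minus_one[of "x / m"] assms
    by (cases "ln (x / m) = x / m - 1") auto
  then show ?thesis
    using assms by (simp add: ln_div diff_divide_distrib)
qed

lemma chord_gap_ln_pos:
  assumes "0 < a" "a < m" "m < b"
  shows "0 < chord_gap ln a m b"
proof -
  have "(b - m) * ln a + (m - a) * ln b
      < (b - m) * (ln m + (a - m) / m) + (m - a) * (ln m + (b - m) / m)"
    using ln_less_tangent[of a m] ln_less_tangent[of b m] assms
    by (intro add_strict_mono mult_strict_left_mono) auto
  also have "\<dots> = (b - a) * ln m"
    using assms by (simp add: field_simps)
  finally show ?thesis
    by (simp add: chord_gap_def)
qed

lemma affine_if_chord_gap_zero:
  assumes "\<And>a m b. 0 < a \<Longrightarrow> a < m \<Longrightarrow> m < b \<Longrightarrow> chord_gap g a m b = 0"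
  obtains A l :: real where "\<forall>x>0. g x = A + l * x"
proof -
  define l where "l = g 2 - g 1"
  have "g x = (g 1 - l) + l * x" if "0 < x" for x
  proof -
    consider "x < 1" | "x = 1" | "1 < x" "x < 2" | "x = 2" | "2 < x"
      by linarith
    then show ?thesis
    proof cases
      case 1
      then show ?thesis using assms[of x 1 2] that by (simp add: chord_gap_def l_def algebra_simps)
    next
      case 3
      then show ?thesis using assms[of 1 x 2] that by (simp add: chord_gap_def l_def algebra_simps)
    next
      case 5
      then show ?thesis using assms[of 1 2 x] that by (simp add: chord_gap_def l_def algebra_simps)
    qed (auto simp: l_def algebra_simps)
  qed
  then show thesis
    using that by blast
qed

text \<open>
  The exponential factors cancel because the deviations \<open>z i - 1\<close> add up to 0. This is why a linear term
  in the logarithm of a density is invisible to the direction of the sample.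
\<close>

lemma prod_tilted_power:
  fixes z :: "'i \<Rightarrow> real"
  assumes "finite I" and "\<And>i. i \<in> I \<Longrightarrow> 0 < z i" and "(\<Sum>i\<in>I. z i) = real (card I)"
  shows "(\<Prod>i\<in>I. c * exp (l * (z i - 1)) * z i powr k) = c ^ card I * (\<Prod>i\<in>I. z i) powr k"
proof -
  have "(\<Prod>i\<in>I. exp (l * (z i - 1))) = exp (\<Sum>i\<in>I. l * (z i - 1))"
    using assms(1) by (simp add: exp_sum)
  also have "(\<Sum>i\<in>I. l * (z i - 1)) = 0"
    using assms(3) by (simp add: sum_distrib_left[symmetric] sum_subtractf)
  finally have e: "(\<Prod>i\<in>I. exp (l * (z i - 1))) = 1"
    by simp
  have "(\<Prod>i\<in>I. z i powr k) = (\<Prod>i\<in>I. z i) powr k"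
    by (rule prod_powr_distrib[symmetric])
  then show ?thesis
    using e by (simp add: prod.distrib)
qed

text \<open>
  The strict inequality of arithmetic and geometric means for numbers of mean 1.
\<close>

lemma prod_less_one:
  fixes z :: "'i \<Rightarrow> real"
  assumes "finite I" and "\<And>i. i \<in> I \<Longrightarrow> 0 < z i" and "(\<Sum>i\<in>I. z i) = real (card I)"
    and "j \<in> I" "z j \<noteq> 1"
  shows "(\<Prod>i\<in>I. z i) < 1"
proof -
  have pos: "0 < (\<Prod>i\<in>I. z i)"
    using assms(2) by (intro prod_pos) auto
  have "ln (\<Prod>i\<in>I. z i) = (\<Sum>i\<in>I. ln (z i))"
  proof (rule ln_prod)
    show "z i \<noteq> 0" if "i \<in> I" for i
      using assms(2)[OF that] by simp
  qed fact
  also have "\<dots> < (\<Sum>i\<in>I. z i - 1)"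
  proof (rule sum_strict_mono_ex1)
    show "\<exists>i\<in>I. ln (z i) < z i - 1"
      using ln_less_tangent[of "z j" 1] assms by auto
    show "\<forall>i\<in>I. ln (z i) \<le> z i - 1"
      using assms(2) ln_le_minus_one by blast
  qed fact
  also have "\<dots> = 0"
    using assms(3) by (simp add: sum_subtractf)
  finally show ?thesis
    using pos by simp
qed

section \<open>Integrals over caps that shrink to the centre\<close>

text \<open>
  The sets \<open>B \<epsilon>\<close> are parts of the simplex of positive vectors of mean 1 that shrink to its
  centre \<open>(1, \<dots>, 1)\<close>. The last assumption says that \<open>\<sigma>\<close> does not concentrate at the centre; without it the comparison of
  different exponents below would not be strict.
\<close>

locale shrinking_caps = finite_measure \<sigma> for \<sigma> :: "(nat \<Rightarrow> real) measure" +
  fixes n :: nat and B :: "real \<Rightarrow> (nat \<Rightarrow> real) set"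
  assumes sets_B [measurable]: "\<And>\<epsilon>. B \<epsilon> \<in> sets \<sigma>"
    and coordinate_measurable [measurable]: "\<And>i. i \<in> {1..n} \<Longrightarrow> (\<lambda>z. z i) \<in> borel_measurable \<sigma>"
    and B_pos: "\<And>z \<epsilon> i. z \<in> B \<epsilon> \<Longrightarrow> i \<in> {1..n} \<Longrightarrow> 0 < z i"
    and B_sum: "\<And>z \<epsilon>. z \<in> B \<epsilon> \<Longrightarrow> (\<Sum>i=1..n. z i) = real n"
    and B_shrinks: "\<And>\<delta>. 0 < \<delta> \<Longrightarrow> \<forall>\<^sub>F \<epsilon> in at_right 0. \<forall>z\<in>B \<epsilon>. \<forall>i\<in>{1..n}. \<bar>z i - 1\<bar> \<le> \<delta>"
    and B_off_centre: "\<And>\<epsilon>. 0 < \<epsilon> \<Longrightarrow> 0 < measure \<sigma> {z \<in> B \<epsilon>. \<exists>i\<in>{1..n}. z i \<noteq> 1}"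
begin

text \<open>
  The integrals are not divided by the mass of the cap, which would cancel in all comparisons below.
\<close>

definition cap_mean :: "(real \<Rightarrow> real) \<Rightarrow> real \<Rightarrow> real \<Rightarrow> real" where
  "cap_mean f \<epsilon> s = (\<integral>z\<in>B \<epsilon>. (\<Prod>i=1..n. f (s * z i)) \<partial>\<sigma>)"

definition power_mean :: "real \<Rightarrow> real \<Rightarrow> real" where
  "power_mean \<epsilon> k = (\<integral>z\<in>B \<epsilon>. (\<Prod>i=1..n. z i) powr k \<partial>\<sigma>)"

lemma sets_off_centre [measurable]: "{z \<in> B \<epsilon>. \<exists>i\<in>{1..n}. z i \<noteq> 1} \<in> sets \<sigma>"
proof -
  have "{z \<in> space \<sigma>. z \<in> B \<epsilon> \<and> (\<exists>i\<in>{1..n}. z i \<noteq> 1)} \<in> sets \<sigma>"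
    by measurable
  also have "{z \<in> space \<sigma>. z \<in> B \<epsilon> \<and> (\<exists>i\<in>{1..n}. z i \<noteq> 1)} = {z \<in> B \<epsilon>. \<exists>i\<in>{1..n}. z i \<noteq> 1}"
    using sets.sets_into_space[OF sets_B] by auto
  finally show ?thesis .
qed

lemma measure_B_pos:
  assumes "0 < \<epsilon>" shows "0 < measure \<sigma> (B \<epsilon>)"
proof -
  have "measure \<sigma> {z \<in> B \<epsilon>. \<exists>i\<in>{1..n}. z i \<noteq> 1} \<le> measure \<sigma> (B \<epsilon>)"
    by (intro finite_measure_mono) auto
  with B_off_centre[OF assms] show ?thesis
    by linarith
qed

lemma set_integrable_B:
  fixes g :: "(nat \<Rightarrow> real) \<Rightarrow> real"
  assumes "g \<in> borel_measurable \<sigma>" "\<And>z. z \<in> B \<epsilon> \<Longrightarrow> \<bar>g z\<bar> \<le> C"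
  shows "set_integrable \<sigma> (B \<epsilon>) g"
  unfolding set_integrable_def
proof (rule integrable_const_bound[where B = "\<bar>C\<bar>"])
  show "AE z in \<sigma>. norm (indicator (B \<epsilon>) z *\<^sub>R g z) \<le> \<bar>C\<bar>"
    using assms(2) by (intro AE_I2) (force simp: indicator_def)
  show "(\<lambda>z. indicator (B \<epsilon>) z *\<^sub>R g z) \<in> borel_measurable \<sigma>"
    using assms(1) by measurable
qed

lemma set_integral_B_mono:
  fixes g h :: "(nat \<Rightarrow> real) \<Rightarrow> real"
  assumes "g \<in> borel_measurable \<sigma>" "\<And>z. z \<in> B \<epsilon> \<Longrightarrow> \<bar>g z\<bar> \<le> C"
    and "h \<in> borel_measurable \<sigma>" "\<And>z. z \<in> B \<epsilon> \<Longrightarrow> \<bar>h z\<bar> \<le> D"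
    and "\<And>z. z \<in> B \<epsilon> \<Longrightarrow> g z \<le> h z"
  shows "(\<integral>z\<in>B \<epsilon>. g z \<partial>\<sigma>) \<le> (\<integral>z\<in>B \<epsilon>. h z \<partial>\<sigma>)"
  by (intro set_integral_mono set_integrable_B[of _ _ C] set_integrable_B[of _ _ D]) (use assms in auto)

lemma set_integral_B_const: "(\<integral>z\<in>B \<epsilon>. c \<partial>\<sigma>) = c * measure \<sigma> (B \<epsilon>)"
  by (simp add: set_lebesgue_integral_def)

lemma prod_powr_measurable [measurable]: "(\<lambda>z. (\<Prod>i=1..n. z i) powr k) \<in> borel_measurable \<sigma>"
  by measurable

lemma prod_f_measurable [measurable]:
  fixes f :: "real \<Rightarrow> real"
  assumes [measurable]: "f \<in> borel_measurable borel"
  shows "(\<lambda>z. \<Prod>i=1..n. f (s * z i)) \<in> borel_measurable \<sigma>"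
  by (intro borel_measurable_prod) measurable

lemma prod_powr_bounded:
  assumes "\<And>i. i \<in> {1..n} \<Longrightarrow> \<bar>z i - 1\<bar> \<le> (1/2 :: real)" "(\<Sum>i=1..n. z i) = real n"
  shows "\<bar>(\<Prod>i=1..n. z i) powr k\<bar> \<le> max 1 (((1/2) ^ n) powr k)"
proof -
  have pos: "0 < z i" "1/2 \<le> z i" if "i \<in> {1..n}" for i
    using assms(1)[OF that] by linarith+
  have lo: "(1/2) ^ n \<le> (\<Prod>i=1..n. z i)"
    using prod_mono[of "{1..n}" "\<lambda>_. 1/2" z] pos by auto
  have hi: "(\<Prod>i=1..n. z i) \<le> 1"
  proof (cases "\<exists>j\<in>{1..n}. z j \<noteq> 1")
    case True
    then show ?thesis
      using prod_less_one[of "{1..n}" z] pos assms(2) by fastforce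
  qed auto
  have p0: "0 < (\<Prod>i=1..n. z i)"
    using pos by (intro prod_pos) auto
  show ?thesis
  proof (cases "0 \<le> k")
    case True
    then have "(\<Prod>i=1..n. z i) powr k \<le> 1"
      using hi p0 powr_mono2[of k "\<Prod>i=1..n. z i" 1] by auto
    then show ?thesis by simp
  next
    case False
    then have "(\<Prod>i=1..n. z i) powr k \<le> ((1/2) ^ n) powr k"
      using lo p0 by (intro powr_mono2') auto
    then show ?thesis by simp
  qed
qed

text \<open>
  By the inequality of arithmetic and geometric means the base of the power is less than 1 off the centre.
  The cap has to be small so that negative powers are bounded, hence integrable.
\<close>

lemma power_mean_strict_antimono:
  assumes "k < k'"
  shows "\<forall>\<^sub>F \<epsilon> in at_right 0. power_mean \<epsilon> k' < power_mean \<epsilon> k"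
proof -
  have "\<forall>\<^sub>F \<epsilon> in at_right 0. \<forall>z\<in>B \<epsilon>. \<forall>i\<in>{1..n}. \<bar>z i - 1\<bar> \<le> 1/2"
    by (intro B_shrinks) simp
  moreover have "\<forall>\<^sub>F \<epsilon> in at_right (0::real). 0 < \<epsilon>"
    by (simp add: eventually_at_right_less)
  ultimately show ?thesis
  proof eventually_elim
    case (elim \<epsilon>)
    let ?P = "\<lambda>z. \<Prod>i=1..n. z i :: real"
    let ?g = "\<lambda>z. ?P z powr k - ?P z powr k'"
    have int: "set_integrable \<sigma> (B \<epsilon>) (\<lambda>z. ?P z powr k)" for k
      using elim B_sum by (intro set_integrable_B[OF _ prod_powr_bounded]) auto
    have pos: "0 < ?P z" if "z \<in> B \<epsilon>" for z
      using B_pos[OF that] by (intro prod_pos) auto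
    have strict: "0 < ?g z" if "z \<in> B \<epsilon>" "j \<in> {1..n}" "z j \<noteq> 1" for z j
    proof -
      have "?P z < 1"
        by (rule prod_less_one[of _ _ j]) (use that B_pos B_sum in auto)
      then show ?thesis
        using pos[OF that(1)] assms by (simp add: powr_less_mono')
    qed
    have nonneg: "0 \<le> ?g z" if "z \<in> B \<epsilon>" for z
    proof (cases "\<exists>j\<in>{1..n}. z j \<noteq> 1")
      case True
      then show ?thesis using strict[OF that] by (meson less_imp_le)
    qed auto
    have "power_mean \<epsilon> k - power_mean \<epsilon> k' = (\<integral>z\<in>B \<epsilon>. ?g z \<partial>\<sigma>)"
      unfolding power_mean_def by (subst set_integral_diff(2)[OF int int]) simp
    moreover have "(\<integral>z\<in>B \<epsilon>. ?g z \<partial>\<sigma>) \<noteq> 0"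
    proof
      assume "(\<integral>z\<in>B \<epsilon>. ?g z \<partial>\<sigma>) = 0"
      then have "AE z in \<sigma>. indicator (B \<epsilon>) z *\<^sub>R ?g z = 0"
        using set_integral_diff(1)[OF int int, of k k'] nonneg unfolding set_lebesgue_integral_def set_integrable_def
        by (subst (asm) integral_nonneg_eq_0_iff_AE) (auto simp: indicator_def)
      then have "AE z in \<sigma>. \<not> (z \<in> B \<epsilon> \<and> (\<exists>i\<in>{1..n}. z i \<noteq> 1))"
        by eventually_elim (use strict in force)
      then have "AE z in \<sigma>. z \<notin> {z \<in> B \<epsilon>. \<exists>i\<in>{1..n}. z i \<noteq> 1}"
        by simp
      then have "measure \<sigma> {z \<in> B \<epsilon>. \<exists>i\<in>{1..n}. z i \<noteq> 1} = 0"
        by (intro measure_eq_0_null_sets) (simp add: AE_iff_null_sets sets_off_centre)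
      with B_off_centre[of \<epsilon>] elim show False by simp
    qed
    moreover have "0 \<le> (\<integral>z\<in>B \<epsilon>. ?g z \<partial>\<sigma>)"
      unfolding set_lebesgue_integral_def using nonneg by (intro Bochner_Integration.integral_nonneg) (auto simp: indicator_def)
    ultimately show ?case by linarith
  qed
qed

lemma eventually_small:
  assumes "0 < \<delta>"
  shows "\<forall>\<^sub>F \<epsilon> in at_right 0. 0 < \<epsilon> \<and> (\<forall>z\<in>B \<epsilon>. \<forall>i\<in>{1..n}. \<bar>z i - 1\<bar> \<le> \<delta>)"
  using eventually_conj[OF eventually_at_right_less[of "0::real"] B_shrinks[OF assms]] .

context
  fixes f :: "real \<Rightarrow> real"
  assumes f_measurable [measurable]: "f \<in> borel_measurable borel"
    and f_pos: "\<And>x. 0 < x \<Longrightarrow> 0 < f x"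
    and f_cont: "continuous_on {0<..} f"
begin

lemma f_bounds_on_cap:
  assumes "0 < u" "u \<le> v" and "\<And>z i. z \<in> B \<epsilon> \<Longrightarrow> i \<in> {1..n} \<Longrightarrow> \<bar>z i - 1\<bar> \<le> 1/2"
  obtains C where "\<And>s z. s \<in> {u..v} \<Longrightarrow> z \<in> B \<epsilon> \<Longrightarrow> \<bar>\<Prod>i=1..n. f (s * z i)\<bar> \<le> C"
proof -
  have "continuous_on {u/2..2 * v} f"
    using f_cont by (rule continuous_on_subset) (use assms(1) in auto)
  then obtain M where M: "\<And>x. x \<in> {u/2..2 * v} \<Longrightarrow> f x \<le> M"
    using continuous_attains_sup[of "{u/2..2 * v}" f] assms(1,2) by fastforce
  have "\<bar>\<Prod>i=1..n. f (s * z i)\<bar> \<le> M ^ n" if "s \<in> {u..v}" "z \<in> B \<epsilon>" for s z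
  proof -
    have "0 \<le> f (s * z i) \<and> f (s * z i) \<le> M" if i: "i \<in> {1..n}" for i
    proof
      have z: "1/2 \<le> z i" "z i \<le> 2"
        using assms(3)[OF \<open>z \<in> B \<epsilon>\<close> i] by linarith+
      have "u * (1/2) \<le> s * z i" "s * z i \<le> v * 2"
        using z \<open>s \<in> {u..v}\<close> assms(1) by (intro mult_mono; simp)+
      then have "s * z i \<in> {u/2..2 * v}"
        by simp
      then show "f (s * z i) \<le> M"
        by (rule M)
      show "0 \<le> f (s * z i)"
        using f_pos[of "s * z i"] z \<open>s \<in> {u..v}\<close> assms(1) by (simp add: less_imp_le)
    qed
    then have "(\<Prod>i=1..n. f (s * z i)) \<le> (\<Prod>i=1..n. M)" "0 \<le> (\<Prod>i=1..n. f (s * z i))"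
      by (intro prod_mono prod_nonneg; simp)+
    then show ?thesis by simp
  qed
  then show thesis by (rule that)
qed

lemma continuous_cap_mean:
  assumes small: "\<And>z i. z \<in> B \<epsilon> \<Longrightarrow> i \<in> {1..n} \<Longrightarrow> \<bar>z i - 1\<bar> \<le> 1/2"
  shows "continuous_on {0<..} (cap_mean f \<epsilon>)"
proof (rule continuous_at_imp_continuous_on, rule ballI)
  fix s0 :: real assume "s0 \<in> {0<..}"
  then have s0: "0 < s0" by simp
  obtain C where C: "\<And>s z. s \<in> {s0/2..2 * s0} \<Longrightarrow> z \<in> B \<epsilon> \<Longrightarrow> \<bar>\<Prod>i=1..n. f (s * z i)\<bar> \<le> C"
    by (rule f_bounds_on_cap[of "s0/2" "2 * s0" \<epsilon>]) (use s0 small in auto)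
  have "continuous_on {s0/2..2 * s0} (cap_mean f \<epsilon>)"
    unfolding continuous_on_sequentially comp_def
  proof (intro allI ballI impI)
    fix x s assume s: "s \<in> {s0/2..2 * s0}" and x: "(\<forall>k. x k \<in> {s0/2..2 * s0}) \<and> x \<longlonglongrightarrow> s"
    show "(\<lambda>k. cap_mean f \<epsilon> (x k)) \<longlonglongrightarrow> cap_mean f \<epsilon> s"
      unfolding cap_mean_def set_lebesgue_integral_def
    proof (rule integral_dominated_convergence[where w = "\<lambda>_. \<bar>C\<bar>"])
      show "AE z in \<sigma>. (\<lambda>k. indicator (B \<epsilon>) z *\<^sub>R (\<Prod>i=1..n. f (x k * z i)))
          \<longlonglongrightarrow> indicator (B \<epsilon>) z *\<^sub>R (\<Prod>i=1..n. f (s * z i))"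
      proof (rule AE_I2)
        fix z
        show "(\<lambda>k. indicator (B \<epsilon>) z *\<^sub>R (\<Prod>i=1..n. f (x k * z i)))
          \<longlonglongrightarrow> indicator (B \<epsilon>) z *\<^sub>R (\<Prod>i=1..n. f (s * z i))"
        proof (cases "z \<in> B \<epsilon>")
          case True
          have "(\<lambda>k. f (x k * z i)) \<longlonglongrightarrow> f (s * z i)" if "i \<in> {1..n}" for i
          proof (rule continuous_on_tendsto_compose[OF f_cont])
            show "(\<lambda>k. x k * z i) \<longlonglongrightarrow> s * z i"
              using x by (intro tendsto_intros) auto
            show "s * z i \<in> {0<..}"
              using s s0 B_pos[OF True that] by simp
            have "0 < x k" for k
              using x s0 by (metis atLeastAtMost_iff half_gt_zero less_le_trans)
            then show "\<forall>\<^sub>F k in sequentially. x k * z i \<in> {0<..}"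
              using B_pos[OF True that] by simp
          qed
          then show ?thesis
            by (intro tendsto_intros) auto
        qed simp
      qed
      show "AE z in \<sigma>. norm (indicator (B \<epsilon>) z *\<^sub>R (\<Prod>i=1..n. f (x k * z i))) \<le> \<bar>C\<bar>" for k
        using C[of "x k"] x by (intro AE_I2) (force simp: indicator_def)
    qed auto
  qed
  then show "isCont (cap_mean f \<epsilon>) s0"
    by (rule continuous_on_interior) (use s0 in simp)
qed

text \<open>
  By continuity of \<open>f\<close> at \<open>s\<close>, all factors are close to \<open>f s\<close> on a small cap.
\<close>

lemma eventually_cap_mean_near:
  assumes "0 < s" "0 < \<delta>" "\<delta> < 1"
  shows "\<forall>\<^sub>F \<epsilon> in at_right 0. ((1 - \<delta>) * f s) ^ n * measure \<sigma> (B \<epsilon>) \<le> cap_mean f \<epsilon> s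
      \<and> cap_mean f \<epsilon> s \<le> ((1 + \<delta>) * f s) ^ n * measure \<sigma> (B \<epsilon>)"
proof -
  have fs: "0 < f s" by (rule f_pos) fact
  have "isCont f s"
    using f_cont assms(1) by (simp add: continuous_on_eq_continuous_at)
  then obtain d where d: "0 < d" "\<And>x. \<bar>x - s\<bar> < d \<Longrightarrow> \<bar>f x - f s\<bar> < \<delta> * f s"
    unfolding continuous_at_eps_delta using assms fs by (metis dist_real_def mult_pos_pos)
  have "0 < min (1/2) (d / (2 * s))"
    using d(1) assms(1) by simp
  from eventually_small[OF this] show ?thesis
  proof eventually_elim
    case (elim \<epsilon>)
    have near: "(1 - \<delta>) * f s \<le> f (s * z i) \<and> f (s * z i) \<le> (1 + \<delta>) * f s"
      if "z \<in> B \<epsilon>" "i \<in> {1..n}" for z i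
    proof -
      have "\<bar>z i - 1\<bar> \<le> d / (2 * s)"
        using elim that by simp
      then have "\<bar>s * z i - s\<bar> \<le> d / 2"
        using assms(1) abs_mult[of s "z i - 1"] by (simp add: field_simps)
      then have "\<bar>f (s * z i) - f s\<bar> < \<delta> * f s"
        using d by (intro d(2)) linarith
      then show ?thesis
        unfolding left_diff_distrib distrib_right by linarith
    qed
    obtain C where C: "\<And>z. z \<in> B \<epsilon> \<Longrightarrow> \<bar>\<Prod>i=1..n. f (s * z i)\<bar> \<le> C"
      by (rule f_bounds_on_cap[of s s \<epsilon>]) (use elim assms(1) in auto)
    have prod_near: "((1 - \<delta>) * f s) ^ n \<le> (\<Prod>i=1..n. f (s * z i)) \<and> (\<Prod>i=1..n. f (s * z i)) \<le> ((1 + \<delta>) * f s) ^ n"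
      if z: "z \<in> B \<epsilon>" for z
    proof -
      have 1: "0 \<le> (1 - \<delta>) * f s" using assms fs by simp
      have 2: "0 \<le> f (s * z i)" if "i \<in> {1..n}" for i
        using f_pos[of "s * z i"] B_pos[OF z that] assms(1) by (simp add: less_imp_le)
      have "(\<Prod>i=1..n. (1 - \<delta>) * f s) \<le> (\<Prod>i=1..n. f (s * z i))"
        using near[OF z] 1 by (intro prod_mono) simp
      moreover have "(\<Prod>i=1..n. f (s * z i)) \<le> (\<Prod>i=1..n. (1 + \<delta>) * f s)"
        using near[OF z] 2 by (intro prod_mono) simp
      ultimately show ?thesis by simp
    qed
    show ?case
      unfolding cap_mean_def set_integral_B_const[symmetric]
      using prod_near C by (intro conjI set_integral_B_mono[OF _ order_refl _ C] set_integral_B_mono[OF _ C _ order_refl]) auto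
  qed
qed

text \<open>
  Divide the hypothesis by the mass of \<open>B \<epsilon>'\<close> and let \<open>\<epsilon>'\<close> tend to 0. The limit is taken in the form of
  two inequalities with relative error \<open>\<delta>\<close>, and \<open>\<delta>\<close> tends to 0 afterwards.
\<close>

lemma cap_mean_factorises:
  assumes "\<forall>\<^sub>F \<epsilon> in at_right 0. \<forall>\<^sub>F \<epsilon>' in at_right 0. \<forall>s>0.
    cap_mean f \<epsilon> s * cap_mean f \<epsilon>' 1 = cap_mean f \<epsilon>' s * cap_mean f \<epsilon> 1"
  shows "\<forall>\<^sub>F \<epsilon> in at_right 0. \<forall>s>0. cap_mean f \<epsilon> s = cap_mean f \<epsilon> 1 / f 1 ^ n * f s ^ n"
  using assms eventually_small[of "1/2", simplified]
proof eventually_elim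
  case (elim \<epsilon>)
  show ?case
  proof (intro allI impI)
    fix s :: real assume s: "0 < s"
    have nonneg: "0 \<le> cap_mean f \<epsilon> s" if "0 < s" for s
      unfolding cap_mean_def set_lebesgue_integral_def
    proof (rule Bochner_Integration.integral_nonneg)
      show "0 \<le> indicator (B \<epsilon>) z *\<^sub>R (\<Prod>i=1..n. f (s * z i))" for z
        using f_pos B_pos[of z \<epsilon>] that by (auto simp: indicator_def less_imp_le intro!: prod_nonneg)
    qed
    define u where "u = cap_mean f \<epsilon> s * f 1 ^ n"
    define v where "v = cap_mean f \<epsilon> 1 * f s ^ n"
    have "(1 - \<delta>) ^ n * u \<le> (1 + \<delta>) ^ n * v \<and> (1 - \<delta>) ^ n * v \<le> (1 + \<delta>) ^ n * u"
      if \<delta>: "0 < \<delta>" "\<delta> < 1" for \<delta>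
    proof -
      have "\<forall>\<^sub>F \<epsilon>' in at_right (0::real). ?thesis"
        using elim(1) eventually_cap_mean_near[OF s \<delta>] eventually_cap_mean_near[OF zero_less_one \<delta>]
          eventually_at_right_less
      proof eventually_elim
        case (elim \<epsilon>')
        let ?V = "measure \<sigma> (B \<epsilon>')"
        have V: "0 < ?V" using elim by (intro measure_B_pos) simp
        have "?V * ((1 - \<delta>) ^ n * u) = cap_mean f \<epsilon> s * (((1 - \<delta>) * f 1) ^ n * ?V)"
          by (simp add: u_def power_mult_distrib)
        also have "\<dots> \<le> cap_mean f \<epsilon> s * cap_mean f \<epsilon>' 1"
          using elim nonneg[OF s] by (intro mult_left_mono) auto
        also have "\<dots> = cap_mean f \<epsilon> 1 * cap_mean f \<epsilon>' s"
          using elim s by simp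
        also have "\<dots> \<le> cap_mean f \<epsilon> 1 * (((1 + \<delta>) * f s) ^ n * ?V)"
          using elim nonneg[of 1] by (intro mult_left_mono) auto
        also have "\<dots> = ?V * ((1 + \<delta>) ^ n * v)"
          by (simp add: v_def power_mult_distrib)
        finally have 1: "(1 - \<delta>) ^ n * u \<le> (1 + \<delta>) ^ n * v"
          using V by simp
        have "?V * ((1 - \<delta>) ^ n * v) = cap_mean f \<epsilon> 1 * (((1 - \<delta>) * f s) ^ n * ?V)"
          by (simp add: v_def power_mult_distrib)
        also have "\<dots> \<le> cap_mean f \<epsilon> 1 * cap_mean f \<epsilon>' s"
          using elim nonneg[of 1] by (intro mult_left_mono) auto
        also have "\<dots> = cap_mean f \<epsilon> s * cap_mean f \<epsilon>' 1"
          using elim s by simp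
        also have "\<dots> \<le> cap_mean f \<epsilon> s * (((1 + \<delta>) * f 1) ^ n * ?V)"
          using elim nonneg[OF s] by (intro mult_left_mono) auto
        also have "\<dots> = ?V * ((1 + \<delta>) ^ n * u)"
          by (simp add: u_def power_mult_distrib)
        finally have 2: "(1 - \<delta>) ^ n * v \<le> (1 + \<delta>) ^ n * u"
          using V by simp
        from 1 2 show ?case ..
      qed
      then show ?thesis by simp
    qed
    then have ev: "\<forall>\<^sub>F \<delta> in at_right 0. (1 - \<delta>) ^ n * u \<le> (1 + \<delta>) ^ n * v \<and> (1 - \<delta>) ^ n * v \<le> (1 + \<delta>) ^ n * u"
      unfolding eventually_at_right_field by (intro exI[of _ 1]) simp
    have lim: "((\<lambda>\<delta>. (1 - \<delta>) ^ n * w) \<longlongrightarrow> (1 - 0) ^ n * w) (at_right 0)"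
      "((\<lambda>\<delta>. (1 + \<delta>) ^ n * w) \<longlongrightarrow> (1 + 0) ^ n * w) (at_right (0::real))" for w :: real
      by (intro tendsto_intros)+
    have "(1 - 0) ^ n * u \<le> (1 + 0) ^ n * v" "(1 - 0) ^ n * v \<le> (1 + 0) ^ n * u"
      by (intro tendsto_le[OF trivial_limit_at_right_real lim(2) lim(1)] eventually_mono[OF ev]; simp)+
    then have "u = v" by simp
    then show "cap_mean f \<epsilon> s = cap_mean f \<epsilon> 1 / f 1 ^ n * f s ^ n"
      using f_pos[of 1] by (simp add: u_def v_def field_simps)
  qed
qed

lemma log_tilt_continuous:
  assumes "0 < a" shows "continuous_on {a..b} (\<lambda>x. ln (f x) + c * ln x)"
proof (intro continuous_intros)
  show "continuous_on {a..b} f"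
    using f_cont by (rule continuous_on_subset) (use assms in auto)
  show "\<forall>x\<in>{a..b}. f x \<noteq> 0"
    using f_pos assms by (metis atLeastAtMost_iff less_irrefl less_le_trans)
qed (use assms in auto)

lemma eventually_cap_in_window:
  assumes "0 < s" "a < s" "s < b"
  shows "\<forall>\<^sub>F \<epsilon> in at_right 0. (\<forall>z\<in>B \<epsilon>. \<forall>i\<in>{1..n}. s * z i \<in> {a..b} \<and> \<bar>z i - 1\<bar> \<le> 1/2)"
proof -
  have "0 < min (1/2) (min ((s - a) / s) ((b - s) / s))"
    using assms by simp
  from eventually_small[OF this] show ?thesis
  proof eventually_elim
    case (elim \<epsilon>)
    have "s * z i \<in> {a..b}" if "z \<in> B \<epsilon>" "i \<in> {1..n}" for z i
    proof -
      have "\<bar>z i - 1\<bar> \<le> (s - a) / s" "\<bar>z i - 1\<bar> \<le> (b - s) / s"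
        using elim that by auto
      then have "\<bar>z i - 1\<bar> * s \<le> s - a" "\<bar>z i - 1\<bar> * s \<le> b - s"
        using assms(1) by (simp_all add: pos_le_divide_eq)
      then have "\<bar>z i * s - s\<bar> \<le> s - a" "\<bar>z i * s - s\<bar> \<le> b - s"
        using abs_mult[of "z i - 1" s] assms(1) by (simp_all add: left_diff_distrib)
      then show ?thesis by (simp add: mult.commute abs_le_iff)
    qed
    with elim show ?case by auto
  qed
qed

text \<open>
  At the point \<open>s\<close> where a line touches \<open>ln f - k ln\<close> from above, \<open>f (s * z)\<close> is at most
  \<open>f s * exp (l * s * (z - 1)) * z powr k\<close> for \<open>z\<close> near 1. In the product over the coordinates the
  exponentials cancel. The bound holds only on caps small enough for \<open>s * z i\<close> to stay in \<open>[a, b]\<close>.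
\<close>

lemma cap_mean_le_power_mean:
  assumes "0 < a" "a < m" "m < b" and gap: "0 < chord_gap (\<lambda>x. ln (f x) + (- k) * ln x) a m b"
  obtains s where "0 < s" "\<forall>\<^sub>F \<epsilon> in at_right 0. cap_mean f \<epsilon> s \<le> f s ^ n * power_mean \<epsilon> k"
proof -
  obtain s l where s: "a < s" "s < b" and
    touch: "\<And>x. x \<in> {a..b} \<Longrightarrow> ln (f x) + (- k) * ln x \<le> ln (f s) + (- k) * ln s + l * (x - s)"
    by (rule tangent_from_above[OF assms(2,3) log_tilt_continuous[OF assms(1), of b "- k"]])
      (use gap in \<open>auto simp: chord_gap_def\<close>)
  have s0: "0 < s" using s assms(1) by simp
  have le: "f (s * z) \<le> f s * exp (l * s * (z - 1)) * z powr k" if z: "s * z \<in> {a..b}" for z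
  proof -
    have z0: "0 < z" using z assms(1) s0 by (metis atLeastAtMost_iff less_le_trans zero_less_mult_pos)
    have "ln (f (s * z)) \<le> ln (f s) + l * s * (z - 1) + k * ln z"
      using touch[OF z] z0 s0 by (simp add: ln_mult algebra_simps)
    then have "exp (ln (f (s * z))) \<le> exp (ln (f s) + l * s * (z - 1) + k * ln z)"
      by simp
    then show ?thesis
      using f_pos s0 z0 by (simp add: exp_add powr_def)
  qed
  from eventually_cap_in_window[OF s0 s]
  have "\<forall>\<^sub>F \<epsilon> in at_right 0. cap_mean f \<epsilon> s \<le> f s ^ n * power_mean \<epsilon> k"
  proof eventually_elim
    case (elim \<epsilon>)
    obtain C where C: "\<And>z. z \<in> B \<epsilon> \<Longrightarrow> \<bar>\<Prod>i=1..n. f (s * z i)\<bar> \<le> C"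
      by (rule f_bounds_on_cap[of s s \<epsilon>]) (use elim s0 in auto)
    define D where "D = max 1 (((1/2) ^ n) powr k)"
    have D: "\<bar>f s ^ n * (\<Prod>i=1..n. z i) powr k\<bar> \<le> f s ^ n * D" if "z \<in> B \<epsilon>" for z
      unfolding abs_mult D_def using elim that B_sum f_pos[OF s0]
      by (intro mult_mono prod_powr_bounded) auto
    have "(\<Prod>i=1..n. f (s * z i)) \<le> f s ^ n * (\<Prod>i=1..n. z i) powr k" if z: "z \<in> B \<epsilon>" for z
    proof -
      have "(\<Prod>i=1..n. f (s * z i)) \<le> (\<Prod>i=1..n. f s * exp (l * s * (z i - 1)) * z i powr k)"
        using le elim z f_pos B_pos[OF z] s0 by (intro prod_mono) (auto intro: less_imp_le)
      also have "\<dots> = f s ^ n * (\<Prod>i=1..n. z i) powr k"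
        using B_pos[OF z] B_sum[OF z] by (subst prod_tilted_power) auto
      finally show ?thesis .
    qed
    then have "cap_mean f \<epsilon> s \<le> (\<integral>z\<in>B \<epsilon>. f s ^ n * (\<Prod>i=1..n. z i) powr k \<partial>\<sigma>)"
      unfolding cap_mean_def by (intro set_integral_B_mono[OF _ C _ D]) auto
    then show ?case
      by (simp add: power_mean_def)
  qed
  with s0 show thesis by (rule that)
qed

text \<open>
  The mirror image of cap_mean_le_power_mean, with a line that touches from below.
\<close>

lemma power_mean_le_cap_mean:
  assumes "0 < a" "a < m" "m < b" and gap: "chord_gap (\<lambda>x. ln (f x) + (- k) * ln x) a m b < 0"
  obtains s where "0 < s" "\<forall>\<^sub>F \<epsilon> in at_right 0. f s ^ n * power_mean \<epsilon> k \<le> cap_mean f \<epsilon> s"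
proof -
  obtain s l where s: "a < s" "s < b" and
    touch: "\<And>x. x \<in> {a..b} \<Longrightarrow> - (ln (f x) + (- k) * ln x) \<le> - (ln (f s) + (- k) * ln s) + l * (x - s)"
    by (rule tangent_from_above[OF assms(2,3) continuous_on_minus[OF log_tilt_continuous[OF assms(1), of b "- k"]]])
      (use gap in \<open>auto simp: chord_gap_def algebra_simps\<close>)
  have s0: "0 < s" using s assms(1) by simp
  have le: "f s * exp (- l * s * (z - 1)) * z powr k \<le> f (s * z)" if z: "s * z \<in> {a..b}" for z
  proof -
    have z0: "0 < z" using z assms(1) s0 by (metis atLeastAtMost_iff less_le_trans zero_less_mult_pos)
    have "ln (f s) + (- l * s * (z - 1)) + k * ln z \<le> ln (f (s * z))"
      using touch[OF z] z0 s0 by (simp add: ln_mult algebra_simps)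
    then have "exp (ln (f s) + (- l * s * (z - 1)) + k * ln z) \<le> f (s * z)"
      using f_pos[of "s * z"] s0 z0 ln_ge_iff by simp
    moreover have "exp (ln (f s) + (- l * s * (z - 1)) + k * ln z) = f s * exp (- l * s * (z - 1)) * z powr k"
      unfolding exp_add using f_pos[OF s0] z0 by (simp add: powr_def)
    ultimately show ?thesis by simp
  qed
  from eventually_cap_in_window[OF s0 s]
  have "\<forall>\<^sub>F \<epsilon> in at_right 0. f s ^ n * power_mean \<epsilon> k \<le> cap_mean f \<epsilon> s"
  proof eventually_elim
    case (elim \<epsilon>)
    obtain C where C: "\<And>z. z \<in> B \<epsilon> \<Longrightarrow> \<bar>\<Prod>i=1..n. f (s * z i)\<bar> \<le> C"
      by (rule f_bounds_on_cap[of s s \<epsilon>]) (use elim s0 in auto)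
    define D where "D = max 1 (((1/2) ^ n) powr k)"
    have D: "\<bar>f s ^ n * (\<Prod>i=1..n. z i) powr k\<bar> \<le> f s ^ n * D" if "z \<in> B \<epsilon>" for z
      unfolding abs_mult D_def using elim that B_sum f_pos[OF s0]
      by (intro mult_mono prod_powr_bounded) auto
    have "f s ^ n * (\<Prod>i=1..n. z i) powr k \<le> (\<Prod>i=1..n. f (s * z i))" if z: "z \<in> B \<epsilon>" for z
    proof -
      have "f s ^ n * (\<Prod>i=1..n. z i) powr k = (\<Prod>i=1..n. f s * exp (- l * s * (z i - 1)) * z i powr k)"
        using B_pos[OF z] B_sum[OF z] by (subst prod_tilted_power) auto
      also have "\<dots> \<le> (\<Prod>i=1..n. f (s * z i))"
        using le elim z f_pos[OF s0] by (intro prod_mono) (auto intro: less_imp_le)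
      finally show ?thesis .
    qed
    then have "(\<integral>z\<in>B \<epsilon>. f s ^ n * (\<Prod>i=1..n. z i) powr k \<partial>\<sigma>) \<le> cap_mean f \<epsilon> s"
      unfolding cap_mean_def by (intro set_integral_B_mono[OF _ D _ C]) auto
    then show ?case
      by (simp add: power_mean_def)
  qed
  with s0 show thesis by (rule that)
qed

text \<open>
  For a triple \<open>a < m < b\<close> let \<open>K a m b\<close> be the exponent for which \<open>ln f - K ln\<close> meets the chord at
  \<open>m\<close>. If two triples had different exponents, two values \<open>k' < k\<close> strictly between them would give
  \<open>power_mean \<epsilon> k' \<le> h \<epsilon> \<le> power_mean \<epsilon> k\<close> for small \<open>\<epsilon>\<close>, against the strict monotonicity in the exponent.
\<close>

theorem power_exp_if_cap_mean_factorises: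
  assumes "\<forall>\<^sub>F \<epsilon> in at_right 0. \<forall>s>0. cap_mean f \<epsilon> s = h \<epsilon> * f s ^ n"
  obtains A l k where "\<forall>x>0. f x = exp (A + l * x) * x powr k"
proof -
  define K where "K a m b = chord_gap (\<lambda>x. ln (f x)) a m b / chord_gap ln a m b" for a m b
  have gap: "chord_gap (\<lambda>x. ln (f x) + (- k) * ln x) a m b = (K a m b - k) * chord_gap ln a m b"
    if "0 < a" "a < m" "m < b" for a m b k
    unfolding chord_gap_add_cmult K_def using chord_gap_ln_pos[OF that] by (simp add: field_simps)
  have K_le: "K a m b \<le> K a' m' b'"
    if t: "0 < a" "a < m" "m < b" and t': "0 < a'" "a' < m'" "m' < b'" for a m b a' m' b'
  proof (rule ccontr)
    assume "\<not> ?thesis"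
    then obtain k' where k': "K a' m' b' < k'" "k' < K a m b"
      using dense[of "K a' m' b'" "K a m b"] by auto
    then obtain k where k: "k' < k" "k < K a m b"
      using dense[of k' "K a m b"] by auto
    have "0 < chord_gap (\<lambda>x. ln (f x) + (- k) * ln x) a m b"
      using k chord_gap_ln_pos[OF t] by (simp only: gap[OF t]) simp
    then obtain s where s: "0 < s" "\<forall>\<^sub>F \<epsilon> in at_right 0. cap_mean f \<epsilon> s \<le> f s ^ n * power_mean \<epsilon> k"
      by (rule cap_mean_le_power_mean[OF t])
    have "chord_gap (\<lambda>x. ln (f x) + (- k') * ln x) a' m' b' < 0"
      using k' chord_gap_ln_pos[OF t'] by (simp only: gap[OF t']) (simp add: mult_less_0_iff)
    then obtain s' where s': "0 < s'" "\<forall>\<^sub>F \<epsilon> in at_right 0. f s' ^ n * power_mean \<epsilon> k' \<le> cap_mean f \<epsilon> s'"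
      by (rule power_mean_le_cap_mean[OF t'])
    have "\<forall>\<^sub>F \<epsilon> in at_right (0::real). False"
      using assms s(2) s'(2) power_mean_strict_antimono[OF k(1)]
    proof eventually_elim
      case (elim \<epsilon>)
      have "f s ^ n * h \<epsilon> \<le> f s ^ n * power_mean \<epsilon> k"
        using elim s(1) by (simp add: mult.commute)
      then have "h \<epsilon> \<le> power_mean \<epsilon> k"
        using f_pos[OF s(1)] by simp
      moreover have "f s' ^ n * power_mean \<epsilon> k' \<le> f s' ^ n * h \<epsilon>"
        using elim s'(1) by (simp add: mult.commute)
      then have "power_mean \<epsilon> k' \<le> h \<epsilon>"
        using f_pos[OF s'(1)] by simp
      ultimately show False using elim by linarith
    qed
    then show False by simp
  qed
  define k where "k = K 1 2 3"
  have "K a m b = k" if "0 < a" "a < m" "m < b" for a m b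
    unfolding k_def using that by (intro antisym K_le) auto
  then have "chord_gap (\<lambda>x. ln (f x) + (- k) * ln x) a m b = 0" if "0 < a" "a < m" "m < b" for a m b
    using gap[OF that, of k] that by simp
  then obtain A l where Al: "\<forall>x>0. ln (f x) + (- k) * ln x = A + l * x"
    by (rule affine_if_chord_gap_zero)
  have "f x = exp (A + l * x) * x powr k" if "0 < x" for x
  proof -
    have "ln (f x) = (A + l * x) + k * ln x"
      using Al that by (simp add: algebra_simps)
    then have "exp (ln (f x)) = exp (A + l * x) * exp (k * ln x)"
      by (simp add: exp_add)
    then show ?thesis
      using f_pos[OF that] that by (simp add: powr_def)
  qed
  then show thesis using that by blast
qed

end

end

section \<open>Order statistics and the statistic \<open>Z\<close>\<close>

lemma order_stat_mult:
  assumes "0 < c" "k \<in> {1..n}"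
  shows "order_stat n (\<lambda>i. c * x i) k = c * order_stat n x k"
proof -
  let ?l = "map x [1..<Suc n]"
  have "sort (map (\<lambda>y. c * y) ?l) = map (\<lambda>y. c * y) (sort ?l)"
  proof (rule properties_for_sort)
    show "mset (map (\<lambda>y. c * y) (sort ?l)) = mset (map (\<lambda>y. c * y) ?l)"
      unfolding mset_map mset_sort ..
    show "sorted (map (\<lambda>y. c * y) (sort ?l))"
      using assms(1) by (intro sorted_map_mono) (auto simp: mono_on_def simp del: map_map)
  qed
  moreover have "k - 1 < length (sort ?l)"
    using assms(2) by auto
  ultimately show ?thesis
    unfolding order_stat_def by (simp add: comp_def del: upt_Suc)
qed

lemma order_stat_mem:
  assumes "k \<in> {1..n}" shows "order_stat n x k \<in> x ` {1..n}"
proof -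
  have "sort (map x [1..<Suc n]) ! (k - 1) \<in> set (sort (map x [1..<Suc n]))"
    using assms by (intro nth_mem) (auto simp del: upt_Suc)
  then show ?thesis
    unfolding order_stat_def by (auto simp del: upt_Suc)
qed

lemma order_stat_bounds:
  assumes "i \<in> {1..n}" shows "order_stat n x 1 \<le> x i" "x i \<le> order_stat n x n"
proof -
  let ?l = "sort (map x [1..<Suc n])"
  have len: "length ?l = n" by simp
  have "x i \<in> set ?l"
    using assms by (auto simp del: upt_Suc)
  then obtain j where j: "j < n" "x i = ?l ! j"
    using len by (metis in_set_conv_nth)
  show "order_stat n x 1 \<le> x i" "x i \<le> order_stat n x n"
    unfolding order_stat_def j(2) using j(1) len
    by (auto intro!: sorted_nth_mono simp del: upt_Suc)
qed

lemma order_stat_cong: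
  assumes "\<And>i. i \<in> {1..n} \<Longrightarrow> x i = y i"
  shows "order_stat n x = order_stat n y"
proof -
  have "map x [1..<Suc n] = map y [1..<Suc n]"
    using assms by (intro map_cong) (auto simp del: upt_Suc)
  then show ?thesis unfolding order_stat_def by (simp only:)
qed

lemma sample_mean_cong:
  assumes "\<And>i. i \<in> {1..n} \<Longrightarrow> x i = y i"
  shows "sample_mean n x = sample_mean n y"
  using assms by (simp add: sample_mean_def)

lemma Z_stat_cong:
  assumes "\<And>i. i \<in> {1..n} \<Longrightarrow> x i = y i"
  shows "Z_stat n a p q x = Z_stat n a p q y"
proof -
  have "order_stat n x = order_stat n y" "sample_mean n x = sample_mean n y"
    using assms by (intro order_stat_cong sample_mean_cong; blast)+
  then show ?thesis by (simp only: Z_stat_def)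
qed

lemma sample_mean_mult: "sample_mean n (\<lambda>i. c * x i) = c * sample_mean n x"
  by (simp add: sample_mean_def sum_distrib_left[symmetric])

lemma sample_mean_pos:
  assumes "0 < n" "\<And>i. i \<in> {1..n} \<Longrightarrow> 0 < x i" shows "0 < sample_mean n x"
  unfolding sample_mean_def using assms by (intro divide_pos_pos sum_pos) auto

lemma Z_stat_mult:
  assumes "0 < c" shows "Z_stat n a p q (\<lambda>i. c * x i) = c powr (p + q) * Z_stat n a p q x"
proof -
  have "\<bar>c * u - c * v\<bar> powr t = c powr t * \<bar>u - v\<bar> powr t" for u v t :: real
  proof -
    have "\<bar>c * u - c * v\<bar> = c * \<bar>u - v\<bar>"
      using assms by (simp add: abs_mult flip: right_diff_distrib)
    then show ?thesis using assms by (simp add: powr_mult)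
  qed
  then show ?thesis
    using assms unfolding Z_stat_def sum_distrib_left
    by (intro sum.cong refl) (simp add: order_stat_mult sample_mean_mult powr_add)
qed

lemma sorted_nth_le_iff:
  fixes t :: "'a :: linorder"
  assumes "sorted xs" "k < length xs"
  shows "xs ! k \<le> t \<longleftrightarrow> k < length (filter (\<lambda>y. y \<le> t) xs)"
proof
  assume le: "xs ! k \<le> t"
  have "xs ! i \<le> t" if "i < Suc k" for i
    using sorted_nth_mono[OF assms(1), of i k] assms(2) le that by simp
  then have "\<forall>y\<in>set (take (Suc k) xs). y \<le> t"
    using assms(2) by (auto simp: in_set_conv_nth)
  then have "filter (\<lambda>y. y \<le> t) (take (Suc k) xs) = take (Suc k) xs"
    by (rule filter_True)
  then have "Suc k \<le> length (filter (\<lambda>y. y \<le> t) (take (Suc k) xs @ drop (Suc k) xs))"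
    using assms(2) unfolding filter_append length_append by simp
  then show "k < length (filter (\<lambda>y. y \<le> t) xs)" by simp
next
  assume lt: "k < length (filter (\<lambda>y. y \<le> t) xs)"
  show "xs ! k \<le> t"
  proof (rule ccontr)
    assume gt: "\<not> xs ! k \<le> t"
    have "\<not> xs ! (k + i) \<le> t" if "k + i < length xs" for i
      using sorted_nth_mono[OF assms(1), of k "k + i"] gt that by auto
    then have "\<forall>y\<in>set (drop k xs). \<not> y \<le> t"
      by (auto simp: in_set_conv_nth)
    then have "filter (\<lambda>y. y \<le> t) (drop k xs) = []"
      by (rule filter_False)
    then have "filter (\<lambda>y. y \<le> t) xs = filter (\<lambda>y. y \<le> t) (take k xs)"
      by (metis append_Nil2 append_take_drop_id filter_append)
    then have "length (filter (\<lambda>y. y \<le> t) xs) \<le> k"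
      by (metis length_filter_le length_take min.bounded_iff)
    with lt show False by simp
  qed
qed

text \<open>
  The form in which an order statistic is seen to be measurable: it only counts coordinates.
\<close>

lemma order_stat_le_iff:
  assumes "k \<in> {1..n}"
  shows "order_stat n x k \<le> t \<longleftrightarrow> k \<le> card {i \<in> {1..n}. x i \<le> t}"
proof -
  let ?l = "map x [1..<Suc n]"
  have "order_stat n x k \<le> t \<longleftrightarrow> k - 1 < length (filter (\<lambda>y. y \<le> t) (sort ?l))"
    unfolding order_stat_def using assms by (intro sorted_nth_le_iff) (auto simp del: upt_Suc)
  also have "length (filter (\<lambda>y. y \<le> t) (sort ?l)) = length (filter (\<lambda>y. y \<le> t) ?l)"
    by (simp add: filter_sort del: upt_Suc)
  also have "\<dots> = length (filter (\<lambda>i. x i \<le> t) [1..<Suc n])"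
    by (simp add: filter_map comp_def del: upt_Suc)
  also have "\<dots> = card {i \<in> {1..n}. x i \<le> t}"
    by (subst distinct_card[symmetric]) (auto intro!: arg_cong[where f = card] simp del: upt_Suc)
  finally show ?thesis using assms by auto
qed

lemma order_stat_measurable:
  assumes "k \<in> {1..n}" and [measurable]: "\<And>i. i \<in> {1..n} \<Longrightarrow> (\<lambda>w. x w i) \<in> borel_measurable M"
  shows "(\<lambda>w. order_stat n (x w) k) \<in> borel_measurable M"
proof (rule borel_measurableI_le)
  fix t
  have "k \<le> card {i \<in> {1..n}. x w i \<le> t} \<longleftrightarrow> (\<exists>J\<in>Pow {1..n}. k \<le> card J \<and> (\<forall>i\<in>J. x w i \<le> t))" for w
  proof
    assume "k \<le> card {i \<in> {1..n}. x w i \<le> t}"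
    then show "\<exists>J\<in>Pow {1..n}. k \<le> card J \<and> (\<forall>i\<in>J. x w i \<le> t)"
      by (intro bexI[of _ "{i \<in> {1..n}. x w i \<le> t}"]) auto
  next
    assume "\<exists>J\<in>Pow {1..n}. k \<le> card J \<and> (\<forall>i\<in>J. x w i \<le> t)"
    then obtain J where J: "J \<subseteq> {i \<in> {1..n}. x w i \<le> t}" "k \<le> card J" by blast
    then show "k \<le> card {i \<in> {1..n}. x w i \<le> t}"
      using card_mono[OF _ J(1)] by simp
  qed
  then have eq: "{w \<in> space M. order_stat n (x w) k \<le> t}
      = {w \<in> space M. \<exists>J\<in>Pow {1..n}. k \<le> card J \<and> (\<forall>i\<in>J. x w i \<le> t)}"
    by (simp add: order_stat_le_iff[OF assms(1)])
  have "Measurable.pred M (\<lambda>w. \<exists>J\<in>Pow {1..n}. k \<le> card J \<and> (\<forall>i\<in>J. x w i \<le> t))"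
  proof (intro pred_intros_finite pred_intros_logic)
    fix J i assume "J \<in> Pow {1..n}" "i \<in> J"
    then have "i \<in> {1..n}" by auto
    note [measurable] = assms(2)[OF this]
    show "Measurable.pred M (\<lambda>w. x w i \<le> t)" by measurable
  qed (auto dest: finite_subset[OF _ finite_atLeastAtMost])
  then show "{w \<in> space M. order_stat n (x w) k \<le> t} \<in> sets M"
    unfolding eq by (rule predE)
qed

lemma sample_mean_measurable [measurable]:
  assumes [measurable]: "\<And>i. i \<in> {1..n} \<Longrightarrow> (\<lambda>w. x w i) \<in> borel_measurable M"
  shows "(\<lambda>w. sample_mean n (x w)) \<in> borel_measurable M"
  unfolding sample_mean_def by measurable

lemma Z_stat_measurable [measurable]:
  assumes [measurable]: "\<And>i. i \<in> {1..n} \<Longrightarrow> (\<lambda>w. x w i) \<in> borel_measurable M"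
  shows "(\<lambda>w. Z_stat n a p q (x w)) \<in> borel_measurable M"
proof -
  note [measurable] = order_stat_measurable[OF _ assms]
  show ?thesis unfolding Z_stat_def by measurable
qed

context
  fixes n :: nat and a :: "nat \<Rightarrow> nat \<Rightarrow> real" and p q :: real
  assumes n: "0 < n" and p: "0 < p" and q: "0 < q"
    and a: "\<And>i j. i \<in> {1..n} \<Longrightarrow> j \<in> {1..n} \<Longrightarrow> 0 \<le> a i j" "0 < a 1 1" "0 < a n n"
begin

text \<open>
  All terms of the double sum are nonnegative, so it dominates its diagonal term.
\<close>

lemma scaled_spread_le:
  assumes "k \<in> {1..n}"
  shows "a k k powr (1 / (p + q)) * \<bar>order_stat n x k - sample_mean n x\<bar> \<le> Z_stat n a p q x powr (1 / (p + q))"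
proof -
  let ?d = "\<lambda>k. \<bar>order_stat n x k - sample_mean n x\<bar>"
  have "a k k * ?d k powr (p + q) = a k k * ?d k powr p * ?d k powr q"
    by (simp add: powr_add)
  also have "\<dots> \<le> (\<Sum>j=1..n. a k j * ?d k powr p * ?d j powr q)"
    using assms a(1) by (intro member_le_sum[of k "{1..n}" "\<lambda>j. a k j * ?d k powr p * ?d j powr q"]) auto
  also have "\<dots> \<le> Z_stat n a p q x"
    unfolding Z_stat_def using assms a(1)
    by (intro member_le_sum[of k "{1..n}" "\<lambda>i. \<Sum>j=1..n. a i j * ?d i powr p * ?d j powr q"] sum_nonneg) auto
  finally have "(a k k * ?d k powr (p + q)) powr (1 / (p + q)) \<le> Z_stat n a p q x powr (1 / (p + q))"
    using assms a(1) p q by (intro powr_mono2) auto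
  then show ?thesis
    using p q by (simp add: powr_mult powr_powr)
qed

text \<open>
  Every observation lies between the smallest and the largest one, whose deviations are controlled by the
  positive weights \<open>a 1 1\<close> and \<open>a n n\<close>.
\<close>

lemma spread_le_Z_stat:
  obtains c where "0 < c"
    "\<And>x i. i \<in> {1..n} \<Longrightarrow> \<bar>x i - sample_mean n x\<bar> \<le> c * Z_stat n a p q x powr (1 / (p + q))"
proof -
  let ?r = "1 / (p + q)"
  define c where "c = max (1 / a 1 1 powr ?r) (1 / a n n powr ?r)"
  have "\<bar>x i - sample_mean n x\<bar> \<le> c * Z_stat n a p q x powr ?r" if i: "i \<in> {1..n}" for x i
  proof -
    have k: "\<bar>order_stat n x k - sample_mean n x\<bar> \<le> c * Z_stat n a p q x powr ?r"
      if "k \<in> {1, n}" for k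
    proof -
      have "0 < a k k powr ?r" using that a by auto
      moreover have "k \<in> {1..n}" using that n by auto
      ultimately have "\<bar>order_stat n x k - sample_mean n x\<bar> \<le> (1 / a k k powr ?r) * Z_stat n a p q x powr ?r"
        using scaled_spread_le[of k x] by (simp add: field_simps)
      also have "\<dots> \<le> c * Z_stat n a p q x powr ?r"
        using that by (intro mult_right_mono) (auto simp: c_def)
      finally show ?thesis .
    qed
    have "\<bar>x i - sample_mean n x\<bar> \<le> max \<bar>order_stat n x 1 - sample_mean n x\<bar> \<bar>order_stat n x n - sample_mean n x\<bar>"
      using order_stat_bounds[OF i, of x] by linarith
    with k[of 1] k[of n] show ?thesis by simp
  qed
  moreover have "0 < c"
    using a by (simp add: c_def less_max_iff_disj)
  ultimately show thesis by (rule that[rotated])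
qed

text \<open>
  Needed to find points with small \<open>Z\<close>: near the diagonal \<open>Z\<close> is small.
\<close>

lemma Z_stat_le_spread:
  obtains C where "0 < C"
    "\<And>x d. 0 \<le> d \<Longrightarrow> (\<And>i. i \<in> {1..n} \<Longrightarrow> \<bar>x i - sample_mean n x\<bar> \<le> d) \<Longrightarrow>
      Z_stat n a p q x powr (1 / (p + q)) \<le> C * d"
proof -
  define S where "S = (\<Sum>i=1..n. \<Sum>j=1..n. a i j)"
  have S: "0 < S"
    unfolding S_def
  proof (rule sum_pos2[of _ 1])
    show "0 < (\<Sum>j=1..n. a 1 j)"
      using a n by (intro sum_pos2[of _ 1]) auto
  qed (use a n in \<open>auto intro!: sum_nonneg\<close>)
  have "Z_stat n a p q x powr (1 / (p + q)) \<le> S powr (1 / (p + q)) * d"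
    if "0 \<le> d" and d: "\<And>i. i \<in> {1..n} \<Longrightarrow> \<bar>x i - sample_mean n x\<bar> \<le> d" for x d
  proof -
    have le: "\<bar>order_stat n x k - sample_mean n x\<bar> powr t \<le> d powr t" if k: "k \<in> {1..n}" and "0 < t" for k t
    proof -
      from order_stat_mem[OF k, of x] obtain i where "i \<in> {1..n}" "order_stat n x k = x i" by auto
      then show ?thesis using d that by (intro powr_mono2) auto
    qed
    have "Z_stat n a p q x \<le> (\<Sum>i=1..n. \<Sum>j=1..n. a i j * d powr p * d powr q)"
      unfolding Z_stat_def using a(1) le p q by (intro sum_mono mult_mono) auto
    also have "\<dots> = S * d powr (p + q)"
      by (simp add: S_def sum_distrib_right powr_add mult.assoc)
    finally have "Z_stat n a p q x powr (1 / (p + q)) \<le> (S * d powr (p + q)) powr (1 / (p + q))"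
      using a(1) p q by (intro powr_mono2) (auto simp: Z_stat_def intro!: sum_nonneg)
    also have "\<dots> = S powr (1 / (p + q)) * d"
      using S \<open>0 \<le> d\<close> p q by (simp add: powr_mult powr_powr)
    finally show ?thesis .
  qed
  moreover have "0 < S powr (1 / (p + q))" using S by simp
  ultimately show thesis by (rule that[rotated])
qed

end

section \<open>Polar coordinates on the positive orthant\<close>

lemma emeasure_lborel_scale:
  fixes A :: "real set"
  assumes "0 < c" "A \<in> sets borel"
  shows "emeasure lborel A = ennreal c * emeasure lborel ((\<lambda>x. c * x) -` A)"
proof -
  have [measurable]: "(\<lambda>x. c * x) -` A \<in> sets borel"
    using measurable_sets[of "\<lambda>x. c * x" borel borel A] assms(2) by simp
  have "emeasure lborel A = (\<integral>\<^sup>+x. indicator A x \<partial>lborel)"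
    using assms(2) by simp
  also have "\<dots> = \<bar>c\<bar> * (\<integral>\<^sup>+x. indicator A (0 + c * x) \<partial>lborel)"
    using assms by (intro nn_integral_real_affine) auto
  also have "(\<integral>\<^sup>+x. indicator A (0 + c * x) \<partial>lborel) = (\<integral>\<^sup>+x. indicator ((\<lambda>x. c * x) -` A) x \<partial>lborel)"
    by (intro nn_integral_cong) (simp add: indicator_def)
  also have "\<dots> = emeasure lborel ((\<lambda>x. c * x) -` A)"
    by simp
  finally show ?thesis using assms(1) by simp
qed

lemma product_sigma_finite_lborel: "product_sigma_finite (\<lambda>_. lborel :: real measure)"
  by (simp add: product_sigma_finite_def sigma_finite_lborel)

lemma scale_coordinates_measurable [measurable]:
  fixes M :: "'a measure" and I :: "'i set"
  assumes [measurable]: "\<And>i. i \<in> I \<Longrightarrow> (\<lambda>w. h w i) \<in> borel_measurable M"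
  shows "(\<lambda>w. \<lambda>i\<in>I. h w i) \<in> measurable M (Pi\<^sub>M I (\<lambda>_. lborel :: real measure))"
  by (intro measurable_restrict) (simp add: assms)

lemma PiM_lborel_scale:
  fixes I :: "'i set"
  assumes "finite I" "0 < c"
  shows "Pi\<^sub>M I (\<lambda>_. lborel) = density (distr (Pi\<^sub>M I (\<lambda>_. lborel)) (Pi\<^sub>M I (\<lambda>_. lborel))
    (\<lambda>x. \<lambda>i\<in>I. c * x i)) (\<lambda>_. ennreal (c ^ card I))"
proof -
  interpret product_sigma_finite "\<lambda>_::'i. lborel :: real measure"
    by (rule product_sigma_finite_lborel)
  let ?L = "Pi\<^sub>M I (\<lambda>_. lborel :: real measure)"
  show ?thesis
  proof (rule PiM_eqI[symmetric, OF assms(1)])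
    fix A :: "'i \<Rightarrow> real set" assume A: "\<And>i. i \<in> I \<Longrightarrow> A i \<in> sets lborel"
    have A' [measurable]: "(\<lambda>x. c * x) -` A i \<in> sets borel" if "i \<in> I" for i
      using measurable_sets[of "\<lambda>x. c * x" borel borel "A i"] A[OF that] by simp
    have P [measurable]: "Pi\<^sub>E I A \<in> sets ?L"
      using A by (intro sets_PiM_I_finite assms)
    have "emeasure (density (distr ?L ?L (\<lambda>x. \<lambda>i\<in>I. c * x i)) (\<lambda>_. ennreal (c ^ card I))) (Pi\<^sub>E I A)
      = ennreal (c ^ card I) * emeasure ?L ((\<lambda>x. \<lambda>i\<in>I. c * x i) -` Pi\<^sub>E I A \<inter> space ?L)"
      by (simp add: emeasure_density nn_integral_cmult_indicator emeasure_distr)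
    also have "(\<lambda>x. \<lambda>i\<in>I. c * x i) -` Pi\<^sub>E I A \<inter> space ?L = Pi\<^sub>E I (\<lambda>i. (\<lambda>x. c * x) -` A i)"
      by (auto simp: space_PiM PiE_iff)
    also have "emeasure ?L \<dots> = (\<Prod>i\<in>I. emeasure lborel ((\<lambda>x. c * x) -` A i))"
      using A' by (intro emeasure_PiM assms) simp
    also have "ennreal (c ^ card I) * \<dots> = (\<Prod>i\<in>I. ennreal c * emeasure lborel ((\<lambda>x. c * x) -` A i))"
      using assms(2) by (simp add: prod.distrib ennreal_power)
    also have "\<dots> = (\<Prod>i\<in>I. emeasure lborel (A i))"
      using A assms(2) by (intro prod.cong refl emeasure_lborel_scale[symmetric]) auto
    finally show "emeasure (density (distr ?L ?L (\<lambda>x. \<lambda>i\<in>I. c * x i)) (\<lambda>_. ennreal (c ^ card I))) (Pi\<^sub>E I A)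
      = (\<Prod>i\<in>I. emeasure lborel (A i))" .
  qed simp
qed

lemma nn_integral_PiM_lborel_scale:
  fixes I :: "'i set"
  assumes "finite I" "0 < c" and [measurable]: "F \<in> borel_measurable (Pi\<^sub>M I (\<lambda>_. lborel))"
  shows "(\<integral>\<^sup>+x. F x \<partial>Pi\<^sub>M I (\<lambda>_. lborel))
    = ennreal (c ^ card I) * (\<integral>\<^sup>+x. F (\<lambda>i\<in>I. c * x i) \<partial>Pi\<^sub>M I (\<lambda>_. lborel))"
  by (subst PiM_lborel_scale[OF assms(1,2)])
    (simp add: nn_integral_density nn_integral_distr nn_integral_cmult)

lemma PiM_density_lborel:
  fixes I :: "'i set" and g :: "real \<Rightarrow> ennreal"
  assumes I: "finite I" and [measurable]: "g \<in> borel_measurable borel"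
    and fin: "sigma_finite_measure (density lborel g)"
  shows "Pi\<^sub>M I (\<lambda>_. density lborel g) = density (Pi\<^sub>M I (\<lambda>_. lborel)) (\<lambda>x. \<Prod>i\<in>I. g (x i))"
proof -
  interpret L: product_sigma_finite "\<lambda>_::'i. lborel :: real measure"
    by (rule product_sigma_finite_lborel)
  interpret product_sigma_finite "\<lambda>_::'i. density lborel g"
    using fin by (simp add: product_sigma_finite_def)
  let ?L = "Pi\<^sub>M I (\<lambda>_. lborel :: real measure)"
  have [measurable]: "(\<lambda>x. \<Prod>i\<in>I. g (x i)) \<in> borel_measurable ?L"
    by (intro borel_measurable_prod_ennreal) measurable
  show ?thesis
  proof (rule PiM_eqI[symmetric, OF I])
    show "sets (density ?L (\<lambda>x. \<Prod>i\<in>I. g (x i))) = sets (Pi\<^sub>M I (\<lambda>_. density lborel g))"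
      by (simp cong: sets_PiM_cong)
    fix A :: "'i \<Rightarrow> real set" assume A: "\<And>i. i \<in> I \<Longrightarrow> A i \<in> sets (density lborel g)"
    have P [measurable]: "Pi\<^sub>E I A \<in> sets ?L"
      using A by (intro sets_PiM_I_finite I) simp
    have "emeasure (density ?L (\<lambda>x. \<Prod>i\<in>I. g (x i))) (Pi\<^sub>E I A)
      = (\<integral>\<^sup>+x. (\<Prod>i\<in>I. g (x i)) * indicator (Pi\<^sub>E I A) x \<partial>?L)"
      by (simp add: emeasure_density)
    also have "\<dots> = (\<integral>\<^sup>+x. (\<Prod>i\<in>I. g (x i) * indicator (A i) (x i)) \<partial>?L)"
    proof (rule nn_integral_cong)
      fix x assume "x \<in> space ?L"
      then have "indicator (Pi\<^sub>E I A) x = (\<Prod>i\<in>I. indicator (A i) (x i) :: ennreal)"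
        using I by (auto simp: indicator_def space_PiM PiE_iff)
      then show "(\<Prod>i\<in>I. g (x i)) * indicator (Pi\<^sub>E I A) x = (\<Prod>i\<in>I. g (x i) * indicator (A i) (x i))"
        by (simp add: prod.distrib)
    qed
    also have "\<dots> = (\<Prod>i\<in>I. \<integral>\<^sup>+x. g x * indicator (A i) x \<partial>lborel)"
      using A by (intro L.product_nn_integral_prod I) auto
    also have "\<dots> = (\<Prod>i\<in>I. emeasure (density lborel g) (A i))"
      using A by (intro prod.cong refl) (simp add: emeasure_density)
    finally show "emeasure (density ?L (\<lambda>x. \<Prod>i\<in>I. g (x i))) (Pi\<^sub>E I A)
      = (\<Prod>i\<in>I. emeasure (density lborel g) (A i))" .
  qed
qed

lemma nn_integral_inverse_power_tail:
  assumes "0 < t" "0 < n"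
  shows "(\<integral>\<^sup>+r. ennreal (real n / r ^ Suc n) * indicator {t..} r \<partial>lborel) = ennreal (1 / t ^ n)"
proof -
  have "(\<integral>\<^sup>+r. ennreal (real n / r ^ Suc n) * indicator {t..} r \<partial>lborel) = ennreal (0 - (- (1 / t ^ n)))"
  proof (rule nn_integral_FTC_atLeast)
    fix r :: real assume "t \<le> r"
    then have r: "0 < r" using assms(1) by simp
    have "((\<lambda>r. - inverse (r ^ n)) has_real_derivative - (- (inverse (r ^ n) * (real n * r ^ (n - 1)) * inverse (r ^ n)))) (at r)"
      using r by (auto intro!: derivative_eq_intros)
    moreover have "- (- (inverse (r ^ n) * (real n * r ^ (n - 1)) * inverse (r ^ n))) = real n / r ^ Suc n"
      using r assms(2) by (cases n) (auto simp: field_simps)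
    ultimately show "((\<lambda>r. - (1 / r ^ n)) has_real_derivative real n / r ^ Suc n) (at r)"
      by (simp add: inverse_eq_divide)
    show "0 \<le> real n / r ^ Suc n" using r by simp
  next
    have "filterlim (\<lambda>r::real. r ^ n) at_top at_top"
      using assms(2) by (intro filterlim_pow_at_top filterlim_ident)
    then have "((\<lambda>r::real. inverse (r ^ n)) \<longlongrightarrow> 0) at_top"
      by (rule tendsto_inverse_0_at_top)
    then show "((\<lambda>r::real. - (1 / r ^ n)) \<longlongrightarrow> 0) at_top"
      using tendsto_minus by (fastforce simp: inverse_eq_divide)
  qed simp
  then show ?thesis by simp
qed

definition orthant :: "nat \<Rightarrow> (nat \<Rightarrow> real) set" where
  "orthant n = {y. \<forall>i\<in>{1..n}. 0 < y i}"

definition open_simplex :: "nat \<Rightarrow> (nat \<Rightarrow> real) set" where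
  "open_simplex n = {z \<in> orthant n. sample_mean n z = 1}"

text \<open>
  The cone measure on the open simplex: a set of directions gets the Lebesgue measure of the part of its cone
  where the mean is at most 1.
\<close>

definition cone_measure :: "nat \<Rightarrow> (nat \<Rightarrow> real) measure" where
  "cone_measure n = distr
     (density (\<Pi>\<^sub>M i\<in>{1..n}. lborel) (\<lambda>y. indicator {y \<in> orthant n. sample_mean n y \<le> 1} y))
     (\<Pi>\<^sub>M i\<in>{1..n}. lborel) (\<lambda>y. \<lambda>i\<in>{1..n}. y i / sample_mean n y)"

context
  fixes n :: nat
  assumes n: "0 < n"
begin

abbreviation "L \<equiv> \<Pi>\<^sub>M i\<in>{1..n}. (lborel :: real measure)"

lemma coordinate_measurable_L: "i \<in> {1..n} \<Longrightarrow> (\<lambda>y. y i) \<in> borel_measurable L"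
  by measurable

lemma mean_measurable_L [measurable]: "sample_mean n \<in> borel_measurable L"
  using sample_mean_measurable[of n "\<lambda>y. y" L] by (simp add: coordinate_measurable_L)

lemma pred_orthant [measurable]: "Measurable.pred L (\<lambda>y. y \<in> orthant n)"
  unfolding orthant_def by measurable

lemma pred_open_simplex [measurable]: "Measurable.pred L (\<lambda>y. y \<in> open_simplex n)"
  unfolding open_simplex_def by measurable

lemma mean_pos_orthant: "y \<in> orthant n \<Longrightarrow> 0 < sample_mean n y"
  using n by (intro sample_mean_pos) (auto simp: orthant_def)

lemma sets_cone_measure [measurable_cong, simp]: "sets (cone_measure n) = sets L"
  by (simp add: cone_measure_def)

lemma space_cone_measure [simp]: "space (cone_measure n) = space L"
  by (simp add: cone_measure_def)

lemma nn_integral_cone_measure: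
  assumes [measurable]: "F \<in> borel_measurable L"
  shows "(\<integral>\<^sup>+z. F z \<partial>cone_measure n)
    = (\<integral>\<^sup>+y. indicator {y \<in> orthant n. sample_mean n y \<le> 1} y * F (\<lambda>i\<in>{1..n}. y i / sample_mean n y) \<partial>L)"
proof -
  let ?D = "\<lambda>y. indicator {y \<in> orthant n. sample_mean n y \<le> 1} y :: ennreal"
  have [measurable]: "(\<lambda>y. \<lambda>i\<in>{1..n}. y i / sample_mean n y) \<in> measurable L L"
    by measurable
  have "(\<integral>\<^sup>+z. F z \<partial>cone_measure n) = (\<integral>\<^sup>+y. F (\<lambda>i\<in>{1..n}. y i / sample_mean n y) \<partial>density L ?D)"
    unfolding cone_measure_def by (rule nn_integral_distr) measurable
  also have "\<dots> = (\<integral>\<^sup>+y. ?D y * F (\<lambda>i\<in>{1..n}. y i / sample_mean n y) \<partial>L)"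
    by (rule nn_integral_density) measurable
  finally show ?thesis .
qed

text \<open>
  Insert the definition of the cone measure on the right-hand side, exchange the integrals, and substitute
  \<open>s = sample_mean n y * r\<close> and then \<open>x = r * y\<close>. The point \<open>x\<close> is counted for all \<open>r\<close> at least its
  mean \<open>t\<close>, and the integral of \<open>n / r ^ (n + 1)\<close> over these \<open>r\<close> is \<open>1 / t ^ n\<close>, which cancels the factor
  \<open>t ^ n\<close> from the first substitution. Only Fubini and the scaling of Lebesgue measure are used.
\<close>

lemma polar_coordinates:
  assumes F [measurable]: "F \<in> borel_measurable L"
  shows "(\<integral>\<^sup>+x. F x * indicator (orthant n) x \<partial>L)
    = (\<integral>\<^sup>+s. ennreal (real n * s ^ (n - 1)) * (\<integral>\<^sup>+z. F (\<lambda>i\<in>{1..n}. s * z i) \<partial>cone_measure n)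
        * indicator {0<..} s \<partial>lborel)"
proof -
  interpret product_sigma_finite "\<lambda>_::nat. lborel :: real measure"
    by (rule product_sigma_finite_lborel)
  interpret L: sigma_finite_measure L
    by (rule sigma_finite) simp
  interpret P: pair_sigma_finite lborel L
    by (intro pair_sigma_finite.intro sigma_finite_lborel L.sigma_finite_measure_axioms)
  let ?m = "sample_mean n"
  let ?D = "\<lambda>y. indicator {y \<in> orthant n. ?m y \<le> 1} y :: ennreal"
  let ?O = "\<lambda>y. indicator (orthant n) y :: ennreal"
  let ?pos = "\<lambda>s. indicator {0<..} s :: ennreal"
  let ?k = "\<lambda>s. ennreal (real n * s ^ (n - 1))"
  have "(\<integral>\<^sup>+s. ?k s * (\<integral>\<^sup>+z. F (\<lambda>i\<in>{1..n}. s * z i) \<partial>cone_measure n) * ?pos s \<partial>lborel)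
    = (\<integral>\<^sup>+s. (\<integral>\<^sup>+y. ?k s * ?D y * F (\<lambda>i\<in>{1..n}. s * (y i / ?m y)) * ?pos s \<partial>L) \<partial>lborel)"
  proof (rule nn_integral_cong)
    fix s
    have Fs: "(\<lambda>z. F (\<lambda>i\<in>{1..n}. s * z i)) \<in> borel_measurable L"
      by measurable
    have "(\<integral>\<^sup>+z. F (\<lambda>i\<in>{1..n}. s * z i) \<partial>cone_measure n)
      = (\<integral>\<^sup>+y. ?D y * F (\<lambda>i\<in>{1..n}. s * (y i / ?m y)) \<partial>L)"
      unfolding nn_integral_cone_measure[OF Fs]
      by (intro nn_integral_cong arg_cong2[where f = "(*)"] refl arg_cong[where f = F]) auto
    then have "?k s * (\<integral>\<^sup>+z. F (\<lambda>i\<in>{1..n}. s * z i) \<partial>cone_measure n) * ?pos s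
      = ?k s * (\<integral>\<^sup>+y. ?D y * F (\<lambda>i\<in>{1..n}. s * (y i / ?m y)) \<partial>L) * ?pos s"
      by (simp only:)
    also have "\<dots> = (\<integral>\<^sup>+y. ?k s * (?D y * F (\<lambda>i\<in>{1..n}. s * (y i / ?m y))) \<partial>L) * ?pos s"
      by (intro arg_cong2[where f = "(*)"] refl nn_integral_cmult[symmetric]) measurable
    also have "\<dots> = (\<integral>\<^sup>+y. ?k s * (?D y * F (\<lambda>i\<in>{1..n}. s * (y i / ?m y))) * ?pos s \<partial>L)"
      by (rule nn_integral_multc[symmetric]) measurable
    finally show "?k s * (\<integral>\<^sup>+z. F (\<lambda>i\<in>{1..n}. s * z i) \<partial>cone_measure n) * ?pos s
      = (\<integral>\<^sup>+y. ?k s * ?D y * F (\<lambda>i\<in>{1..n}. s * (y i / ?m y)) * ?pos s \<partial>L)"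
      by (simp only: mult.assoc)
  qed
  also have "\<dots> = (\<integral>\<^sup>+y. (\<integral>\<^sup>+s. ?k s * ?D y * F (\<lambda>i\<in>{1..n}. s * (y i / ?m y)) * ?pos s \<partial>lborel) \<partial>L)"
    by (rule P.Fubini'[symmetric]) measurable
  also have "\<dots> = (\<integral>\<^sup>+y. (\<integral>\<^sup>+r. ?k r * (?D y * ennreal (?m y ^ n)) * F (\<lambda>i\<in>{1..n}. r * y i) * ?pos r \<partial>lborel) \<partial>L)"
  proof (rule nn_integral_cong)
    fix y assume y [measurable]: "y \<in> space L"
    show "(\<integral>\<^sup>+s. ?k s * ?D y * F (\<lambda>i\<in>{1..n}. s * (y i / ?m y)) * ?pos s \<partial>lborel)
      = (\<integral>\<^sup>+r. ?k r * (?D y * ennreal (?m y ^ n)) * F (\<lambda>i\<in>{1..n}. r * y i) * ?pos r \<partial>lborel)"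
    proof (cases "y \<in> orthant n")
      case True
      then have t: "0 < ?m y" by (rule mean_pos_orthant)
      have meas: "(\<lambda>s. ?k s * ?D y * F (\<lambda>i\<in>{1..n}. s * (y i / ?m y)) * ?pos s) \<in> borel_measurable borel"
        by measurable
      have "(\<integral>\<^sup>+s. ?k s * ?D y * F (\<lambda>i\<in>{1..n}. s * (y i / ?m y)) * ?pos s \<partial>lborel)
        = ennreal \<bar>?m y\<bar> * (\<integral>\<^sup>+r. ?k (0 + ?m y * r) * ?D y * F (\<lambda>i\<in>{1..n}. (0 + ?m y * r) * (y i / ?m y)) * ?pos (0 + ?m y * r) \<partial>lborel)"
        using t by (intro nn_integral_real_affine[OF meas]) simp
      also have "\<dots> = (\<integral>\<^sup>+r. ennreal \<bar>?m y\<bar> * (?k (0 + ?m y * r) * ?D y * F (\<lambda>i\<in>{1..n}. (0 + ?m y * r) * (y i / ?m y)) * ?pos (0 + ?m y * r)) \<partial>lborel)"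
        by (rule nn_integral_cmult[symmetric]) measurable
      also have "\<dots> = (\<integral>\<^sup>+r. ?k r * (?D y * ennreal (?m y ^ n)) * F (\<lambda>i\<in>{1..n}. r * y i) * ?pos r \<partial>lborel)"
      proof (rule nn_integral_cong)
        fix r
        show "ennreal \<bar>?m y\<bar> * (?k (0 + ?m y * r) * ?D y * F (\<lambda>i\<in>{1..n}. (0 + ?m y * r) * (y i / ?m y)) * ?pos (0 + ?m y * r))
          = ?k r * (?D y * ennreal (?m y ^ n)) * F (\<lambda>i\<in>{1..n}. r * y i) * ?pos r"
        proof (cases "0 < r")
          case True
          have "?m y * (?m y * r) ^ (n - 1) = r ^ (n - 1) * ?m y ^ n"
            using n by (cases n) (simp_all add: power_mult_distrib)
          then have k: "ennreal \<bar>?m y\<bar> * ?k (0 + ?m y * r) = ?k r * ennreal (?m y ^ n)"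
            using t True by (simp add: ennreal_mult[symmetric] mult.left_commute)
          have arg: "(\<lambda>i\<in>{1..n}. (0 + ?m y * r) * (y i / ?m y)) = (\<lambda>i\<in>{1..n}. r * y i)"
            using t by auto
          have pos: "?pos (0 + ?m y * r) = ?pos r"
            using t True by simp
          have "ennreal \<bar>?m y\<bar> * (?k (0 + ?m y * r) * ?D y * F (\<lambda>i\<in>{1..n}. (0 + ?m y * r) * (y i / ?m y)) * ?pos (0 + ?m y * r))
            = (ennreal \<bar>?m y\<bar> * ?k (0 + ?m y * r)) * (?D y * F (\<lambda>i\<in>{1..n}. (0 + ?m y * r) * (y i / ?m y)) * ?pos (0 + ?m y * r))"
            by (simp only: mult.assoc)
          then show ?thesis
            unfolding k arg pos by (simp only: mult_ac)
        qed (use t in \<open>simp add: zero_less_mult_iff\<close>)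
      qed
      finally show ?thesis .
    qed (simp add: indicator_def)
  qed
  also have "\<dots> = (\<integral>\<^sup>+r. (\<integral>\<^sup>+y. ?k r * (?D y * ennreal (?m y ^ n)) * F (\<lambda>i\<in>{1..n}. r * y i) * ?pos r \<partial>L) \<partial>lborel)"
    by (rule P.Fubini') measurable
  also have "\<dots> = (\<integral>\<^sup>+r. (\<integral>\<^sup>+x. ennreal (real n / r ^ Suc n) * (if ?m x \<le> r then 1 else 0) * (ennreal (?m x ^ n) * (F x * ?O x)) \<partial>L) \<partial>lborel)"
  proof (rule nn_integral_cong)
    fix r :: real
    show "(\<integral>\<^sup>+y. ?k r * (?D y * ennreal (?m y ^ n)) * F (\<lambda>i\<in>{1..n}. r * y i) * ?pos r \<partial>L)
      = (\<integral>\<^sup>+x. ennreal (real n / r ^ Suc n) * (if ?m x \<le> r then 1 else 0) * (ennreal (?m x ^ n) * (F x * ?O x)) \<partial>L)"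
    proof (cases "0 < r")
      case False
      have zero: "ennreal (real n / r ^ Suc n) * (if ?m x \<le> r then 1 else 0) * (ennreal (?m x ^ n) * (F x * ?O x)) = 0" for x
        using False mean_pos_orthant[of x] by (auto simp: indicator_def)
      show ?thesis
        unfolding zero using False by simp
    next
      case True
      let ?G = "\<lambda>x. ennreal (real n / r ^ Suc n) * (if ?m x \<le> r then 1 else 0) * (ennreal (?m x ^ n) * (F x * ?O x))"
      have meas [measurable]: "?G \<in> borel_measurable L"
        by measurable
      have "(\<integral>\<^sup>+x. ?G x \<partial>L) = ennreal (r ^ n) * (\<integral>\<^sup>+y. ?G (\<lambda>i\<in>{1..n}. r * y i) \<partial>L)"
        using nn_integral_PiM_lborel_scale[OF _ True meas] by simp
      also have "\<dots> = (\<integral>\<^sup>+y. ennreal (r ^ n) * ?G (\<lambda>i\<in>{1..n}. r * y i) \<partial>L)"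
        by (rule nn_integral_cmult[symmetric]) measurable
      also have "\<dots> = (\<integral>\<^sup>+y. ?k r * (?D y * ennreal (?m y ^ n)) * F (\<lambda>i\<in>{1..n}. r * y i) * ?pos r \<partial>L)"
      proof (rule nn_integral_cong)
        fix y
        have m: "?m (\<lambda>i\<in>{1..n}. r * y i) = r * ?m y"
          using sample_mean_cong[of n "\<lambda>i\<in>{1..n}. r * y i" "\<lambda>i. r * y i"] by (simp add: sample_mean_mult)
        have o: "(\<lambda>i\<in>{1..n}. r * y i) \<in> orthant n \<longleftrightarrow> y \<in> orthant n"
          using True by (auto simp: orthant_def zero_less_mult_iff)
        show "ennreal (r ^ n) * ?G (\<lambda>i\<in>{1..n}. r * y i) = ?k r * (?D y * ennreal (?m y ^ n)) * F (\<lambda>i\<in>{1..n}. r * y i) * ?pos r"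
        proof (cases "y \<in> orthant n \<and> ?m y \<le> 1")
          case D: True
          then have t: "0 < ?m y" using mean_pos_orthant by blast
          have "r ^ n * (real n / r ^ Suc n) * (r * ?m y) ^ n = real n * r ^ (n - 1) * ?m y ^ n"
            using True n by (cases n) (simp_all add: power_mult_distrib)
          then have w: "ennreal (r ^ n) * ennreal (real n / r ^ Suc n) * ennreal ((r * ?m y) ^ n) = ?k r * ennreal (?m y ^ n)"
            using True t by (simp add: ennreal_mult[symmetric] del: power_Suc)
          have ones: "(if r * ?m y \<le> r then 1 else 0) = (1 :: ennreal)" "?O (\<lambda>i\<in>{1..n}. r * y i) = 1" "?D y = 1" "?pos r = 1"
            using D o True by (simp_all add: indicator_def)
          have "ennreal (r ^ n) * ?G (\<lambda>i\<in>{1..n}. r * y i)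
            = (ennreal (r ^ n) * ennreal (real n / r ^ Suc n) * ennreal ((r * ?m y) ^ n)) * F (\<lambda>i\<in>{1..n}. r * y i)"
            unfolding m ones by (simp only: mult_1_right mult.assoc)
          then show ?thesis
            unfolding w ones by (simp only: mult_1_right mult_1_left)
        next
          case D: False
          then have "y \<notin> orthant n \<or> \<not> r * ?m y \<le> r"
            using True by (auto simp: mult_le_cancel_left1)
          then have "?G (\<lambda>i\<in>{1..n}. r * y i) = 0"
            unfolding m using o by (auto simp: indicator_def)
          moreover have "?D y = 0"
            using D by (auto simp: indicator_def)
          ultimately show ?thesis by simp
        qed
      qed
      finally show ?thesis by simp
    qed
  qed
  also have "\<dots> = (\<integral>\<^sup>+x. (\<integral>\<^sup>+r. ennreal (real n / r ^ Suc n) * (if ?m x \<le> r then 1 else 0) * (ennreal (?m x ^ n) * (F x * ?O x)) \<partial>lborel) \<partial>L)"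
    by (rule P.Fubini'[symmetric]) measurable
  also have "\<dots> = (\<integral>\<^sup>+x. F x * ?O x \<partial>L)"
  proof (rule nn_integral_cong)
    fix x
    have "(\<integral>\<^sup>+r. ennreal (real n / r ^ Suc n) * (if ?m x \<le> r then 1 else 0) * (ennreal (?m x ^ n) * (F x * ?O x)) \<partial>lborel)
      = (\<integral>\<^sup>+r. ennreal (real n / r ^ Suc n) * (if ?m x \<le> r then 1 else 0) \<partial>lborel) * (ennreal (?m x ^ n) * (F x * ?O x))"
      by (rule nn_integral_multc) measurable
    also have "(\<integral>\<^sup>+r. ennreal (real n / r ^ Suc n) * (if ?m x \<le> r then 1 else 0) \<partial>lborel)
      = (\<integral>\<^sup>+r. ennreal (real n / r ^ Suc n) * indicator {?m x..} r \<partial>lborel)"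
      by (intro nn_integral_cong) (simp add: indicator_def)
    also have "\<dots> * (ennreal (?m x ^ n) * (F x * ?O x)) = F x * ?O x"
    proof (cases "x \<in> orthant n")
      case True
      then have t: "0 < ?m x" by (rule mean_pos_orthant)
      have "ennreal (1 / ?m x ^ n) * ennreal (?m x ^ n) = 1"
        using t by (simp add: ennreal_mult[symmetric])
      then show ?thesis
        unfolding nn_integral_inverse_power_tail[OF t n] by (simp add: mult.assoc[symmetric])
    qed simp
    finally show "(\<integral>\<^sup>+r. ennreal (real n / r ^ Suc n) * (if ?m x \<le> r then 1 else 0) * (ennreal (?m x ^ n) * (F x * ?O x)) \<partial>lborel)
      = F x * ?O x" .
  qed
  finally show ?thesis by simp
qed

end

context
  fixes n :: nat
  assumes n: "0 < n"
begin

lemma finite_measure_cone_measure: "finite_measure (cone_measure n)"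
proof
  interpret product_sigma_finite "\<lambda>_::nat. lborel :: real measure"
    by (rule product_sigma_finite_lborel)
  have "emeasure (cone_measure n) (space (cone_measure n)) = (\<integral>\<^sup>+z. 1 \<partial>cone_measure n)"
    by simp
  also have "\<dots> = (\<integral>\<^sup>+y. indicator {y \<in> orthant n. sample_mean n y \<le> 1} y * 1 \<partial>L n)"
    by (rule nn_integral_cone_measure[OF n]) simp
  also have "\<dots> \<le> (\<integral>\<^sup>+y. indicator (Pi\<^sub>E {1..n} (\<lambda>_. {0..real n})) y \<partial>L n)"
  proof (rule nn_integral_mono)
    fix y assume y: "y \<in> space (L n)"
    have "y i \<le> real n" if "y \<in> orthant n" "sample_mean n y \<le> 1" "i \<in> {1..n}" for i
    proof -
      have "y i \<le> (\<Sum>i=1..n. y i)"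
        using that by (intro member_le_sum) (auto simp: orthant_def less_imp_le)
      also have "\<dots> \<le> real n"
        using that(2) n by (simp add: sample_mean_def)
      finally show ?thesis .
    qed
    then show "indicator {y \<in> orthant n. sample_mean n y \<le> 1} y * 1 \<le> (indicator (Pi\<^sub>E {1..n} (\<lambda>_. {0..real n})) y :: ennreal)"
      using y by (auto simp: indicator_def space_PiM PiE_iff orthant_def less_imp_le)
  qed
  also have "\<dots> = emeasure (L n) (Pi\<^sub>E {1..n} (\<lambda>_. {0..real n}))"
    by (intro nn_integral_indicator sets_PiM_I_finite) auto
  also have "\<dots> = (\<Prod>i=1..n. emeasure lborel {0..real n})"
    by (intro emeasure_PiM) auto
  also have "\<dots> < \<infinity>"
    by (simp add: ennreal_power power_less_top_ennreal)
  finally show "emeasure (cone_measure n) (space (cone_measure n)) \<noteq> \<infinity>"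
    by simp
qed

lemma projection_in_open_simplex:
  assumes "y \<in> orthant n"
  shows "(\<lambda>i\<in>{1..n}. y i / sample_mean n y) \<in> open_simplex n"
proof -
  have m: "0 < sample_mean n y"
    using assms by (rule mean_pos_orthant[OF n])
  have "sample_mean n (\<lambda>i\<in>{1..n}. y i / sample_mean n y) = sample_mean n (\<lambda>i. (1 / sample_mean n y) * y i)"
    by (intro sample_mean_cong) simp
  also have "\<dots> = 1"
    unfolding sample_mean_mult using m by simp
  finally show ?thesis
    using m assms by (simp add: open_simplex_def orthant_def)
qed

lemma AE_cone_measure: "AE z in cone_measure n. z \<in> open_simplex n"
proof -
  note [measurable] = pred_open_simplex[OF n]
  have meas0: "(\<lambda>z. indicator (- open_simplex n) z :: ennreal) \<in> borel_measurable (L n)"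
    by measurable
  then have meas: "(\<lambda>z. indicator (- open_simplex n) z :: ennreal) \<in> borel_measurable (cone_measure n)"
    by (simp only: measurable_cong_sets[OF sets_cone_measure[OF n] refl])
  have "(\<integral>\<^sup>+z. indicator (- open_simplex n) z \<partial>cone_measure n)
    = (\<integral>\<^sup>+y. indicator {y \<in> orthant n. sample_mean n y \<le> 1} y
          * indicator (- open_simplex n) (\<lambda>i\<in>{1..n}. y i / sample_mean n y) \<partial>L n)"
    by (rule nn_integral_cone_measure[OF n meas0])
  also have "\<dots> = (\<integral>\<^sup>+y. 0 \<partial>L n)"
    using projection_in_open_simplex by (intro nn_integral_cong) (simp add: indicator_def)
  finally have "(\<integral>\<^sup>+z. indicator (- open_simplex n) z \<partial>cone_measure n) = 0"
    by simp
  then have "AE z in cone_measure n. indicator (- open_simplex n) z = (0::ennreal)"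
    by (subst (asm) nn_integral_0_iff_AE) (simp_all only: meas)
  then show ?thesis
    by eventually_elim (simp add: indicator_def split: if_splits)
qed

text \<open>
  A small box near the diagonal whose first side lies above the others contains no point with equal
  coordinates, and all its points project close to the centre.
\<close>

lemma cone_measure_off_centre:
  assumes "2 \<le> n" "0 < \<delta>"
  shows "0 < emeasure (cone_measure n)
    {z \<in> space (L n). z \<in> open_simplex n \<and> (\<forall>i\<in>{1..n}. \<bar>z i - 1\<bar> \<le> \<delta>) \<and> (\<exists>i\<in>{1..n}. z i \<noteq> 1)}"
    (is "0 < emeasure _ ?S")
proof -
  interpret product_sigma_finite "\<lambda>_::nat. lborel :: real measure"
    by (rule product_sigma_finite_lborel)
  note [measurable] = pred_open_simplex[OF n]
  have S [measurable]: "?S \<in> sets (L n)"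
    by measurable
  \<comment> \<open>The coordinates and the mean of a point of the box lie between \<open>(1 - \<eta>) / 2\<close> and \<open>(1 + \<eta>) / 2\<close>, so the
    projected coordinates differ from 1 by at most \<open>4 * \<eta>\<close>, and the mean is at most 1.\<close>
  define \<eta> where "\<eta> = min (1/2) (\<delta> / 4)"
  have \<eta>: "0 < \<eta>" "\<eta> \<le> 1/2" "4 * \<eta> \<le> \<delta>"
    using assms(2) by (auto simp: \<eta>_def)
  define A where "A i = (if i = 1 then {1/2<..<(1 + \<eta>) / 2} else {(1 - \<eta>) / 2<..<1/2})" for i :: nat
  have A: "A i \<in> sets lborel" "0 < emeasure lborel (A i)" for i
    using \<eta> by (auto simp: A_def field_simps)
  have "0 < (\<Prod>i=1..n. emeasure lborel (A i))"
    using A(2) by (simp add: zero_less_iff_neq_zero)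
  also have "\<dots> = emeasure (L n) (Pi\<^sub>E {1..n} A)"
    using A(1) by (intro emeasure_PiM[symmetric]) auto
  also have "\<dots> = (\<integral>\<^sup>+y. indicator (Pi\<^sub>E {1..n} A) y \<partial>L n)"
    using A(1) by (intro nn_integral_indicator[symmetric] sets_PiM_I_finite) auto
  also have "\<dots> \<le> (\<integral>\<^sup>+y. indicator {y \<in> orthant n. sample_mean n y \<le> 1} y
      * indicator ?S (\<lambda>i\<in>{1..n}. y i / sample_mean n y) \<partial>L n)"
  proof (rule nn_integral_mono)
    fix y
    show "indicator (Pi\<^sub>E {1..n} A) y \<le> (indicator {y \<in> orthant n. sample_mean n y \<le> 1} y
      * indicator ?S (\<lambda>i\<in>{1..n}. y i / sample_mean n y) :: ennreal)"
    proof (cases "y \<in> Pi\<^sub>E {1..n} A")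
      case True
      let ?m = "sample_mean n y"
      have yA: "y i \<in> A i" if "i \<in> {1..n}" for i
        using True that by (auto simp: PiE_iff)
      have y: "(1 - \<eta>) / 2 \<le> y i" "y i \<le> (1 + \<eta>) / 2" if "i \<in> {1..n}" for i
        using yA[OF that] \<eta> by (auto simp: A_def split: if_splits)
      have orth: "y \<in> orthant n"
        using y(1) \<eta> by (force simp: orthant_def)
      have "(\<Sum>i=1..n. (1 - \<eta>) / 2) \<le> (\<Sum>i=1..n. y i)" "(\<Sum>i=1..n. y i) \<le> (\<Sum>i=1..n. (1 + \<eta>) / 2)"
        using y by (intro sum_mono; simp)+
      then have m: "(1 - \<eta>) / 2 \<le> ?m" "?m \<le> (1 + \<eta>) / 2"
        using n by (simp_all add: sample_mean_def field_simps)
      then have m0: "1/4 \<le> ?m" "?m \<le> 1" using \<eta> by auto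
      have near: "\<bar>y i / ?m - 1\<bar> \<le> \<delta>" if "i \<in> {1..n}" for i
      proof -
        have "\<bar>y i / ?m - 1\<bar> = \<bar>y i - ?m\<bar> / ?m"
        proof -
          have "y i / ?m - 1 = (y i - ?m) / ?m"
            using m0 by (simp add: diff_divide_distrib)
          then show ?thesis using m0 by simp
        qed
        also have "\<dots> \<le> \<eta> / ?m"
          using y[OF that] m m0 by (intro divide_right_mono) (auto simp: abs_le_iff field_simps)
        also have "\<dots> \<le> \<eta> / (1/4)"
          using m0 \<eta> by (intro divide_left_mono) auto
        finally show ?thesis using \<eta> by simp
      qed
      have "y 2 < y 1"
        using yA[of 1] yA[of 2] assms(1) by (simp add: A_def)
      then have "y 1 / ?m \<noteq> 1 \<or> y 2 / ?m \<noteq> 1"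
        using m0 by (auto simp: field_simps)
      moreover have "(1::nat) \<in> {1..n}" "2 \<in> {1..n}" using assms(1) by auto
      ultimately have "\<exists>i\<in>{1..n}. y i / ?m \<noteq> 1" by blast
      then have "(\<lambda>i\<in>{1..n}. y i / ?m) \<in> ?S"
        using near projection_in_open_simplex[OF orth] by (auto simp: space_PiM PiE_iff)
      then show ?thesis
        using orth m0 by (simp add: indicator_def)
    qed simp
  qed
  also have "\<dots> = (\<integral>\<^sup>+z. indicator ?S z \<partial>cone_measure n)"
    by (rule nn_integral_cone_measure[OF n, symmetric]) measurable
  also have "\<dots> = emeasure (cone_measure n) ?S"
    using S by (intro nn_integral_indicator) (simp only: sets_cone_measure[OF n])
  finally show ?thesis .
qed

end

section \<open>Gamma densities\<close>

lemma continuous_eq_if_AE_eq: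
  fixes u v :: "real \<Rightarrow> real"
  assumes "open S" "continuous_on S u" "continuous_on S v" "AE s in lborel. s \<in> S \<longrightarrow> u s = v s"
    and "s \<in> S"
  shows "u s = v s"
proof -
  define N where "N = {s \<in> S. u s - v s \<in> - {0}}"
  have "continuous_on S (\<lambda>s. u s - v s)"
    using assms by (intro continuous_intros)
  then have "open (S \<inter> (\<lambda>s. u s - v s) -` (- {0}))"
    using assms(1) by (rule continuous_open_preimage) auto
  then have "open N"
    by (simp add: N_def Int_def vimage_def)
  moreover have "N \<in> null_sets lborel"
    unfolding AE_iff_null_sets[OF borel_open[OF \<open>open N\<close>, folded sets_lborel]]
    using assms(4) by eventually_elim (auto simp: N_def)
  then have "negligible N"
    by (simp add: negligible_iff_null_sets null_sets_completionI)
  ultimately have "N = {}"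
    using open_not_negligible by blast
  then show ?thesis
    using assms(5) by (auto simp: N_def)
qed

text \<open>
  Used twice against the finiteness of the integral of a density: near 0, if the exponent is at most -1, and
  near infinity, if the exponential does not decay.
\<close>

lemma log_le_nn_integral:
  fixes h :: "real \<Rightarrow> real"
  assumes "0 < u" "u \<le> v" "0 \<le> c" "\<And>x. x \<in> {u..v} \<Longrightarrow> c / x \<le> h x"
  shows "ennreal (c * (ln v - ln u)) \<le> (\<integral>\<^sup>+x. ennreal (h x) * indicator {0<..} x \<partial>lborel)"
proof -
  have "(\<integral>\<^sup>+x. ennreal (c / x) * indicator {u..v} x \<partial>lborel) = ennreal (c * ln v - c * ln u)"
    using assms(1,2,3) by (intro nn_integral_FTC_Icc) (auto intro!: derivative_eq_intros)
  moreover have "(\<integral>\<^sup>+x. ennreal (c / x) * indicator {u..v} x \<partial>lborel) \<le> (\<integral>\<^sup>+x. ennreal (h x) * indicator {0<..} x \<partial>lborel)"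
    using assms by (intro nn_integral_mono) (auto simp: indicator_def intro!: ennreal_leI)
  ultimately show ?thesis
    by (simp add: right_diff_distrib)
qed

lemma nn_integral_gamma_kernel:
  assumes "0 < a" "0 < b"
  shows "(\<integral>\<^sup>+x. ennreal (x powr (a - 1) * exp (- x / b)) * indicator {0<..} x \<partial>lborel) = ennreal (Gamma a * b powr a)"
proof -
  let ?g = "\<lambda>x. ennreal (x powr (a - 1) * exp (- x / b)) * indicator {0<..} x"
  have "(\<integral>\<^sup>+x. ?g x \<partial>lborel) = ennreal \<bar>b\<bar> * (\<integral>\<^sup>+t. ?g (0 + b * t) \<partial>lborel)"
    using assms by (intro nn_integral_real_affine) auto
  also have "(\<integral>\<^sup>+t. ?g (0 + b * t) \<partial>lborel)
    = (\<integral>\<^sup>+t. ennreal (b powr (a - 1)) * ennreal (indicator {0..} t * t powr (a - 1) / exp t) \<partial>lborel)"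
  proof (rule nn_integral_cong_AE)
    show "AE t in lborel. ?g (0 + b * t) = ennreal (b powr (a - 1)) * ennreal (indicator {0..} t * t powr (a - 1) / exp t)"
      using AE_lborel_singleton[of "0::real"]
    proof eventually_elim
      case (elim t)
      have "(b * t) powr (a - 1) * exp (- (b * t) / b) = b powr (a - 1) * (t powr (a - 1) / exp t)" if "0 < t"
        using assms that by (simp add: powr_mult exp_minus field_simps)
      then show ?case
        using assms elim by (cases "0 < t") (auto simp: indicator_def zero_less_mult_iff ennreal_mult'[symmetric])
    qed
  qed
  also have "\<dots> = ennreal (b powr (a - 1)) * ennreal (Gamma a)"
    by (subst nn_integral_cmult) (simp_all add: Gamma_conv_nn_integral_real[OF assms(1), symmetric])
  also have "ennreal \<bar>b\<bar> * \<dots> = ennreal (Gamma a * b powr a)"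
    using assms Gamma_real_pos[OF assms(1)] powr_mult_base[of b "a - 1"]
    by (simp add: ennreal_mult[symmetric] mult.assoc[symmetric])
  finally show ?thesis .
qed

lemma gamma_distribution_if_power_exp:
  fixes f :: "real \<Rightarrow> real"
  assumes [measurable]: "f \<in> borel_measurable borel"
    and F: "F = density lborel (\<lambda>x. ennreal (f x))" and "prob_space F"
    and pos: "AE x in F. 0 < x" and nonneg: "\<And>x. 0 \<le> f x"
    and f: "\<And>x. 0 < x \<Longrightarrow> f x = exp (A + l * x) * x powr k"
  shows "gamma_distribution F"
proof -
  interpret prob_space F by fact
  have f0: "AE x in lborel. x \<le> 0 \<longrightarrow> f x = 0"
    using pos unfolding F by (subst (asm) AE_density) (auto elim!: eventually_mono simp: ennreal_less_zero_iff nonneg less_le[of 0 "f _"])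
  have "1 = emeasure F (space F)"
    by (simp add: emeasure_space_1)
  also have "\<dots> = (\<integral>\<^sup>+x. ennreal (f x) \<partial>lborel)"
    unfolding F by (simp add: emeasure_density)
  also have "\<dots> = (\<integral>\<^sup>+x. ennreal (f x) * indicator {0<..} x \<partial>lborel)"
    using f0 by (intro nn_integral_cong_AE) (auto elim!: eventually_mono simp: indicator_def)
  finally have total: "(\<integral>\<^sup>+x. ennreal (f x) * indicator {0<..} x \<partial>lborel) = 1" by simp
  have log_le: "c * (ln v - ln u) \<le> 1"
    if "0 < u" "u \<le> v" "0 \<le> c" "\<And>x. x \<in> {u..v} \<Longrightarrow> c / x \<le> f x" for u v c
    using log_le_nn_integral[OF that] unfolding total by (simp add: ennreal_le_1)
  have k: "- 1 < k"
  proof (rule ccontr)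
    assume "\<not> ?thesis"
    then have k1: "k \<le> - 1" by simp
    define c where "c = exp (A - \<bar>l\<bar>)"
    have c: "0 < c" by (simp add: c_def)
    \<comment> \<open>The lower end of the interval is chosen such that the left-hand side equals 2.\<close>
    have "c * (ln 1 - ln (exp (- 2 / c))) \<le> 1"
    proof (rule log_le)
      show "exp (- 2 / c) \<le> 1" using c by simp
      fix x assume "x \<in> {exp (- 2 / c)..1}"
      then have x: "0 < x" "x \<le> 1"
        by (auto intro: less_le_trans[OF exp_gt_zero])
      have "\<bar>l * x\<bar> \<le> \<bar>l\<bar>"
        using x by (simp add: abs_mult mult_left_le)
      then have "c \<le> exp (A + l * x)"
        by (simp add: c_def)
      moreover have "1 / x \<le> x powr k"
        using powr_mono'[OF k1, of x] x by (simp add: powr_neg_one)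
      ultimately have "c * (1 / x) \<le> exp (A + l * x) * x powr k"
        using x by (intro mult_mono) auto
      then show "c / x \<le> f x" using f[OF x(1)] by simp
    qed (use c in auto)
    then show False using c by simp
  qed
  have l: "l < 0"
  proof (rule ccontr)
    assume "\<not> ?thesis"
    then have l0: "0 \<le> l" by simp
    define c where "c = exp A"
    have c: "0 < c" by (simp add: c_def)
    have "c * (ln (exp (2 / c)) - ln 1) \<le> 1"
    proof (rule log_le)
      show "1 \<le> exp (2 / c)" using c by simp
      fix x assume "x \<in> {1..exp (2 / c)}"
      then have x: "1 \<le> x" by simp
      have "c \<le> exp (A + l * x)"
        using x l0 by (simp add: c_def)
      moreover have "1 / x \<le> x powr k"
        using powr_mono[of "- 1" k x] k x by (simp add: powr_neg_one)
      ultimately have "c * (1 / x) \<le> exp (A + l * x) * x powr k"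
        using x by (intro mult_mono) auto
      then show "c / x \<le> f x" using f[of x] x by simp
    qed (use c in auto)
    then show False using c by simp
  qed
  define a b where "a = k + 1" and "b = - 1 / l"
  have ab: "0 < a" "0 < b" using k l by (auto simp: a_def b_def divide_pos_neg)
  have f_kernel: "f x = exp A * (x powr (a - 1) * exp (- x / b))" if "0 < x" for x
    using f[OF that] l by (simp add: a_def b_def exp_add field_simps)
  have "1 = (\<integral>\<^sup>+x. ennreal (exp A) * (ennreal (x powr (a - 1) * exp (- x / b)) * indicator {0<..} x) \<partial>lborel)"
    unfolding total[symmetric] by (intro nn_integral_cong) (auto simp: indicator_def f_kernel ennreal_mult)
  also have "\<dots> = ennreal (exp A) * ennreal (Gamma a * b powr a)"
    by (subst nn_integral_cmult) (measurable, simp only: nn_integral_gamma_kernel[OF ab])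
  also have "\<dots> = ennreal (exp A * (Gamma a * b powr a))"
    by (rule ennreal_mult'[symmetric]) simp
  finally have "exp A * (Gamma a * b powr a) = 1"
    by (metis ennreal_eq_1)
  moreover have "0 < Gamma a * b powr a"
    using Gamma_real_pos[OF ab(1)] ab by simp
  ultimately have "exp A = 1 / (Gamma a * b powr a)"
    by (metis less_irrefl nonzero_eq_divide_eq)
  then have "AE x in lborel. ennreal (f x) = ennreal (gamma_density a b x)"
    using f0 by (auto elim!: eventually_mono simp: gamma_density_def f_kernel)
  then have "F = density lborel (\<lambda>x. ennreal (gamma_density a b x))"
    unfolding F by (intro density_cong) (auto simp: gamma_density_def)
  with ab show ?thesis
    unfolding gamma_distribution_def by blast
qed

section \<open>Mean and shape of an independent sample\<close>

lemma (in prob_space) indep_var_iff_emeasure: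
  fixes A B :: "'a \<Rightarrow> real"
  assumes [measurable]: "A \<in> borel_measurable M" "B \<in> borel_measurable M"
  shows "indep_var borel A borel B \<longleftrightarrow>
    (\<forall>U\<in>sets borel. \<forall>V\<in>sets borel. emeasure M {w \<in> space M. A w \<in> U \<and> B w \<in> V}
      = emeasure M {w \<in> space M. A w \<in> U} * emeasure M {w \<in> space M. B w \<in> V})"
    (is "_ \<longleftrightarrow> ?product")
proof -
  have e: "emeasure (distr M (borel \<Otimes>\<^sub>M borel) (\<lambda>w. (A w, B w))) (U \<times> V) = emeasure M {w \<in> space M. A w \<in> U \<and> B w \<in> V}"
    "emeasure (distr M borel A) U = emeasure M {w \<in> space M. A w \<in> U}"
    "emeasure (distr M borel B) V = emeasure M {w \<in> space M. B w \<in> V}"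
    if [measurable]: "U \<in> sets borel" "V \<in> sets borel" for U V
    by (auto simp: emeasure_distr vimage_def Int_def conj_ac intro!: arg_cong[where f = "emeasure M"])
  interpret A: prob_space "distr M borel A" by (rule prob_space_distr) measurable
  interpret B: prob_space "distr M borel B" by (rule prob_space_distr) measurable
  show ?thesis
  proof
    assume "indep_var borel A borel B"
    then have d: "distr M borel A \<Otimes>\<^sub>M distr M borel B = distr M (borel \<Otimes>\<^sub>M borel) (\<lambda>w. (A w, B w))"
      by (simp add: indep_var_distribution_eq)
    show ?product
    proof (intro ballI)
      fix U V :: "real set" assume UV: "U \<in> sets borel" "V \<in> sets borel"
      have "emeasure (distr M borel A \<Otimes>\<^sub>M distr M borel B) (U \<times> V) = emeasure (distr M borel A) U * emeasure (distr M borel B) V"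
        using UV by (intro B.emeasure_pair_measure_Times) auto
      then show "emeasure M {w \<in> space M. A w \<in> U \<and> B w \<in> V}
          = emeasure M {w \<in> space M. A w \<in> U} * emeasure M {w \<in> space M. B w \<in> V}"
        unfolding d e[OF UV] .
    qed
  next
    assume ?product
    then have "distr M borel A \<Otimes>\<^sub>M distr M borel B = distr M (borel \<Otimes>\<^sub>M borel) (\<lambda>w. (A w, B w))"
      by (intro pair_measure_eqI A.sigma_finite_measure_axioms B.sigma_finite_measure_axioms)
        (simp_all add: e cong: sets_pair_measure_cong)
    then show "indep_var borel A borel B"
      by (simp add: indep_var_distribution_eq)
  qed
qed

text \<open>
  The statistic \<open>W\<close> stands for any measurable function of the direction of the sample. Its argument is
  extensional, that is, undefined outside \<open>{1..n}\<close>, because product measures live on such functions.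
\<close>

locale iid_sample = prob_space M for M :: "'w measure" +
  fixes X :: "nat \<Rightarrow> 'w \<Rightarrow> real" and n :: nat and f :: "real \<Rightarrow> real" and W :: "(nat \<Rightarrow> real) \<Rightarrow> real"
  assumes n_pos: "0 < n"
    and indep_X: "indep_vars (\<lambda>_. borel) X {1..n}"
    and f_measurable [measurable]: "f \<in> borel_measurable borel"
    and distr_X: "\<And>i. i \<in> {1..n} \<Longrightarrow> distr M borel (X i) = density lborel (\<lambda>x. ennreal (f x))"
    and X_pos: "\<And>i. i \<in> {1..n} \<Longrightarrow> AE w in M. 0 < X i w"
    and W_measurable [measurable]: "W \<in> borel_measurable (\<Pi>\<^sub>M i\<in>{1..n}. (lborel :: real measure))"
    and W_scale: "\<And>z s. z \<in> open_simplex n \<Longrightarrow> 0 < s \<Longrightarrow> W (\<lambda>i\<in>{1..n}. s * z i) = W z"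
begin

abbreviation "sample w \<equiv> \<lambda>i\<in>{1..n}. X i w"

abbreviation "\<sigma> \<equiv> cone_measure n"

text \<open>
  Up to the factor \<open>n * s ^ (n - 1)\<close> this is the density, at \<open>s\<close>, of the sample mean restricted to the event
  that \<open>W\<close> lies in \<open>V\<close>.
\<close>

definition ray_mass :: "real set \<Rightarrow> real \<Rightarrow> ennreal" where
  "ray_mass V s = (\<integral>\<^sup>+z. (\<Prod>i=1..n. ennreal (f (s * z i))) * indicator V (W z) \<partial>\<sigma>)"

lemma X_measurable [measurable]: "i \<in> {1..n} \<Longrightarrow> X i \<in> borel_measurable M"
  using indep_X by (simp add: indep_vars_def)

lemma sample_measurable [measurable]: "sample \<in> measurable M (L n)"
  by measurable

lemmas [measurable] = mean_measurable_L[OF n_pos] pred_orthant[OF n_pos] pred_open_simplex[OF n_pos]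
lemmas [measurable_cong] = sets_cone_measure[OF n_pos]

lemma mean_sample: "sample_mean n (sample w) = sample_mean n (\<lambda>i. X i w)"
  by (intro sample_mean_cong) simp

lemma distr_sample: "distr M (L n) sample = density (L n) (\<lambda>x. \<Prod>i=1..n. ennreal (f (x i)))"
proof -
  have one: "1 \<in> {1..n}" using n_pos by simp
  have "distr M (L n) sample = distr M (\<Pi>\<^sub>M i\<in>{1..n}. borel) sample"
    by (intro distr_cong refl sets_PiM_cong) simp
  also have "\<dots> = (\<Pi>\<^sub>M i\<in>{1..n}. distr M borel (X i))"
    using indep_X one by (subst (asm) indep_vars_iff_distr_eq_PiM') (auto simp: X_measurable)
  also have "\<dots> = (\<Pi>\<^sub>M i\<in>{1..n}. density lborel (\<lambda>x. ennreal (f x)))"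
    by (intro PiM_cong refl distr_X)
  also have "\<dots> = density (L n) (\<lambda>x. \<Prod>i=1..n. ennreal (f (x i)))"
  proof (rule PiM_density_lborel)
    interpret P: prob_space "distr M borel (X 1)"
      by (rule prob_space_distr) (rule X_measurable[OF one])
    show "sigma_finite_measure (density lborel (\<lambda>x. ennreal (f x)))"
      using P.sigma_finite_measure_axioms unfolding distr_X[OF one] .
  qed auto
  finally show ?thesis .
qed

lemma emeasure_mean_shape:
  assumes [measurable]: "U \<in> sets borel" "V \<in> sets borel"
  shows "emeasure M {w \<in> space M. sample_mean n (\<lambda>i. X i w) \<in> U \<and> W (sample w) \<in> V}
    = (\<integral>\<^sup>+s. ennreal (real n * s ^ (n - 1)) * ray_mass V s * indicator {0<..} s * indicator U s \<partial>lborel)"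
proof -
  let ?S = "{x \<in> space (L n). sample_mean n x \<in> U \<and> W x \<in> V}"
  let ?p = "\<lambda>x. \<Prod>i=1..n. ennreal (f (x i))"
  have [measurable]: "?p \<in> borel_measurable (L n)"
    by (intro borel_measurable_prod_ennreal) measurable
  have AE_pos: "AE w in M. sample w \<in> orthant n"
  proof -
    have "AE w in M. \<forall>i\<in>{1..n}. 0 < X i w"
      using X_pos by (intro AE_finite_allI) auto
    then show ?thesis by eventually_elim (simp add: orthant_def)
  qed
  have "emeasure M {w \<in> space M. sample_mean n (\<lambda>i. X i w) \<in> U \<and> W (sample w) \<in> V}
    = emeasure M {w \<in> space M. sample w \<in> ?S \<and> sample w \<in> orthant n}"
    unfolding mean_sample[symmetric]
  proof (rule emeasure_eq_AE)
    show "AE w in M. w \<in> {w \<in> space M. sample_mean n (sample w) \<in> U \<and> W (sample w) \<in> V}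
        \<longleftrightarrow> w \<in> {w \<in> space M. sample w \<in> ?S \<and> sample w \<in> orthant n}"
      using AE_pos by eventually_elim (auto simp: space_PiM)
  qed measurable
  also have "\<dots> = emeasure (distr M (L n) sample) {x \<in> space (L n). x \<in> ?S \<and> x \<in> orthant n}"
  proof (subst emeasure_distr)
    show "{x \<in> space (L n). x \<in> ?S \<and> x \<in> orthant n} \<in> sets (L n)"
      by measurable
  qed (auto intro!: arg_cong[where f = "emeasure M"] simp: space_PiM)
  also have "\<dots> = (\<integral>\<^sup>+x. ?p x * indicator {x \<in> space (L n). x \<in> ?S \<and> x \<in> orthant n} x \<partial>L n)"
    unfolding distr_sample by (rule emeasure_density) measurable
  also have "\<dots> = (\<integral>\<^sup>+x. (?p x * (indicator U (sample_mean n x) * indicator V (W x))) * indicator (orthant n) x \<partial>L n)"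
    by (intro nn_integral_cong) (auto simp: indicator_def)
  also have "\<dots> = (\<integral>\<^sup>+s. ennreal (real n * s ^ (n - 1)) *
      (\<integral>\<^sup>+z. ?p (\<lambda>i\<in>{1..n}. s * z i) * (indicator U (sample_mean n (\<lambda>i\<in>{1..n}. s * z i)) * indicator V (W (\<lambda>i\<in>{1..n}. s * z i))) \<partial>\<sigma>)
      * indicator {0<..} s \<partial>lborel)"
    by (rule polar_coordinates[OF n_pos]) measurable
  also have "\<dots> = (\<integral>\<^sup>+s. ennreal (real n * s ^ (n - 1)) * ray_mass V s * indicator {0<..} s * indicator U s \<partial>lborel)"
  proof (rule nn_integral_cong)
    fix s :: real
    show "ennreal (real n * s ^ (n - 1)) *
      (\<integral>\<^sup>+z. ?p (\<lambda>i\<in>{1..n}. s * z i) * (indicator U (sample_mean n (\<lambda>i\<in>{1..n}. s * z i)) * indicator V (W (\<lambda>i\<in>{1..n}. s * z i))) \<partial>\<sigma>)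
      * indicator {0<..} s = ennreal (real n * s ^ (n - 1)) * ray_mass V s * indicator {0<..} s * indicator U s"
    proof (cases "0 < s")
      case True
      have [measurable]: "(\<lambda>z. \<Prod>i=1..n. ennreal (f (s * z i))) \<in> borel_measurable (L n)"
        by (intro borel_measurable_prod_ennreal) measurable
      have "(\<integral>\<^sup>+z. ?p (\<lambda>i\<in>{1..n}. s * z i) * (indicator U (sample_mean n (\<lambda>i\<in>{1..n}. s * z i)) * indicator V (W (\<lambda>i\<in>{1..n}. s * z i))) \<partial>\<sigma>)
        = (\<integral>\<^sup>+z. (\<Prod>i=1..n. ennreal (f (s * z i))) * indicator V (W z) * indicator U s \<partial>\<sigma>)"
      proof (rule nn_integral_cong_AE)
        show "AE z in \<sigma>. ?p (\<lambda>i\<in>{1..n}. s * z i) * (indicator U (sample_mean n (\<lambda>i\<in>{1..n}. s * z i)) * indicator V (W (\<lambda>i\<in>{1..n}. s * z i)))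
          = (\<Prod>i=1..n. ennreal (f (s * z i))) * indicator V (W z) * indicator U s"
          using AE_cone_measure[OF n_pos]
        proof eventually_elim
          case (elim z)
          have "sample_mean n (\<lambda>i\<in>{1..n}. s * z i) = sample_mean n (\<lambda>i. s * z i)"
            by (intro sample_mean_cong) simp
          then have "sample_mean n (\<lambda>i\<in>{1..n}. s * z i) = s"
            using elim by (simp add: sample_mean_mult open_simplex_def)
          moreover have "?p (\<lambda>i\<in>{1..n}. s * z i) = (\<Prod>i=1..n. ennreal (f (s * z i)))"
            by (intro prod.cong) auto
          ultimately show ?case
            using W_scale[OF elim True] by (simp only: mult_ac)
        qed
      qed
      also have "\<dots> = ray_mass V s * indicator U s"
        unfolding ray_mass_def by (rule nn_integral_multc) measurable
      finally show ?thesis using True by (simp add: mult_ac)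
    qed simp
  qed
  finally show ?thesis .
qed

abbreviation "mean_shape_indep \<equiv> indep_var borel (\<lambda>w. sample_mean n (\<lambda>i. X i w)) borel (\<lambda>w. W (sample w))"

lemma mean_measurable [measurable]: "(\<lambda>w. sample_mean n (\<lambda>i. X i w)) \<in> borel_measurable M"
  by measurable

lemma mean_shape_indep_iff:
  "mean_shape_indep \<longleftrightarrow> (\<forall>U\<in>sets borel. \<forall>V\<in>sets borel.
    emeasure M {w \<in> space M. sample_mean n (\<lambda>i. X i w) \<in> U \<and> W (sample w) \<in> V}
      = emeasure M {w \<in> space M. sample_mean n (\<lambda>i. X i w) \<in> U} * emeasure M {w \<in> space M. W (sample w) \<in> V})"
  by (rule indep_var_iff_emeasure) measurable

text \<open>
  The joint probabilities factor as \<open>\<mu> U * \<nu> V\<close>. The two factors need not be probabilities; their total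
  masses multiply to 1, which suffices for independence.
\<close>

theorem indep_if_power_exp:
  assumes f: "\<And>x. 0 < x \<Longrightarrow> f x = exp (A + l * x) * x powr k"
  shows mean_shape_indep
proof -
  define \<mu> where "\<mu> U = (\<integral>\<^sup>+s. ennreal (real n * s ^ (n - 1)) * ennreal (f s ^ n) * indicator {0<..} s * indicator U s \<partial>lborel)" for U
  define \<nu> where "\<nu> V = (\<integral>\<^sup>+z. ennreal ((\<Prod>i=1..n. z i) powr k) * indicator V (W z) \<partial>\<sigma>)" for V
  have ray: "ray_mass V s = ennreal (f s ^ n) * \<nu> V" if s: "0 < s" and [measurable]: "V \<in> sets borel" for s V
  proof -
    have "ray_mass V s = (\<integral>\<^sup>+z. ennreal (f s ^ n) * (ennreal ((\<Prod>i=1..n. z i) powr k) * indicator V (W z)) \<partial>\<sigma>)"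
      unfolding ray_mass_def
    proof (rule nn_integral_cong_AE)
      show "AE z in \<sigma>. (\<Prod>i=1..n. ennreal (f (s * z i))) * indicator V (W z)
        = ennreal (f s ^ n) * (ennreal ((\<Prod>i=1..n. z i) powr k) * indicator V (W z))"
        using AE_cone_measure[OF n_pos]
      proof eventually_elim
        case (elim z)
        have z: "0 < z i" if "i \<in> {1..n}" for i
          using elim that by (simp add: open_simplex_def orthant_def)
        have sum: "(\<Sum>i=1..n. z i) = real n"
          using elim n_pos by (simp add: open_simplex_def sample_mean_def)
        have "f (s * z i) = f s * exp (l * s * (z i - 1)) * z i powr k" if "i \<in> {1..n}" for i
          using f[of "s * z i"] f[of s] s z[OF that]
          by (simp add: powr_mult exp_add[symmetric] algebra_simps)
        then have "(\<Prod>i=1..n. f (s * z i)) = f s ^ n * (\<Prod>i=1..n. z i) powr k"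
          using prod_tilted_power[of "{1..n}" z "f s" "l * s" k] z sum by simp
        moreover have "(\<Prod>i=1..n. ennreal (f (s * z i))) = ennreal (\<Prod>i=1..n. f (s * z i))"
          using f s z by (intro prod_ennreal) simp
        moreover have "0 \<le> f s ^ n"
          using f[OF s] by simp
        ultimately show ?case
          by (simp add: ennreal_mult mult.assoc)
      qed
    qed
    also have "\<dots> = ennreal (f s ^ n) * \<nu> V"
      unfolding \<nu>_def by (rule nn_integral_cmult) measurable
    finally show ?thesis .
  qed
  have product: "emeasure M {w \<in> space M. sample_mean n (\<lambda>i. X i w) \<in> U \<and> W (sample w) \<in> V} = \<mu> U * \<nu> V"
    if [measurable]: "U \<in> sets borel" "V \<in> sets borel" for U V
  proof -
    have "emeasure M {w \<in> space M. sample_mean n (\<lambda>i. X i w) \<in> U \<and> W (sample w) \<in> V}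
      = (\<integral>\<^sup>+s. (ennreal (real n * s ^ (n - 1)) * ennreal (f s ^ n) * indicator {0<..} s * indicator U s) * \<nu> V \<partial>lborel)"
      unfolding emeasure_mean_shape[OF that]
      by (intro nn_integral_cong) (auto simp: indicator_def ray that mult_ac)
    also have "\<dots> = \<mu> U * \<nu> V"
      unfolding \<mu>_def by (rule nn_integral_multc) measurable
    finally show ?thesis .
  qed
  have total: "\<mu> UNIV * \<nu> UNIV = 1"
    using product[of UNIV UNIV] by (simp add: emeasure_space_1)
  show ?thesis
    unfolding mean_shape_indep_iff
  proof (intro ballI)
    fix U V :: "real set" assume UV: "U \<in> sets borel" "V \<in> sets borel"
    have "\<mu> U * \<nu> V = (\<mu> U * \<nu> V) * (\<mu> UNIV * \<nu> UNIV)"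
      by (simp add: total)
    also have "\<dots> = (\<mu> U * \<nu> UNIV) * (\<mu> UNIV * \<nu> V)"
      by (simp only: mult_ac)
    finally show "emeasure M {w \<in> space M. sample_mean n (\<lambda>i. X i w) \<in> U \<and> W (sample w) \<in> V}
      = emeasure M {w \<in> space M. sample_mean n (\<lambda>i. X i w) \<in> U} * emeasure M {w \<in> space M. W (sample w) \<in> V}"
      using product[OF UV] product[of U UNIV] product[of UNIV V] UV by simp
  qed
qed

text \<open>
  Independence says that \<open>ray_mass {..\<epsilon>} s\<close> is \<open>P(W \<le> \<epsilon>)\<close> times \<open>ray_mass UNIV s\<close> for almost every
  \<open>s\<close>. Continuity of \<open>ray_mass UNIV\<close> is not clear, because \<open>f\<close> may be unbounded near 0. On a small cap all
  coordinates of \<open>s * z\<close> are comparable to \<open>s\<close>, so \<open>ray_mass {..\<epsilon>}\<close> is continuous. After \<open>ray_mass UNIV\<close> has been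
  eliminated between two small caps, the identity therefore holds for every \<open>s\<close>.
\<close>

theorem power_exp_if_indep:
  assumes n2: "2 \<le> n"
    and f_pos: "\<And>x. 0 < x \<Longrightarrow> 0 < f x" and f_cont: "continuous_on {0<..} f"
    and W_lower: "\<And>z i. z \<in> open_simplex n \<Longrightarrow> i \<in> {1..n} \<Longrightarrow> \<bar>z i - 1\<bar> \<le> c * W z"
    and W_upper: "\<And>z d. z \<in> open_simplex n \<Longrightarrow> 0 \<le> d \<Longrightarrow> (\<And>i. i \<in> {1..n} \<Longrightarrow> \<bar>z i - 1\<bar> \<le> d) \<Longrightarrow> W z \<le> C * d"
    and c: "0 < c" and C: "0 < C"
    and indep: mean_shape_indep
  obtains A l k where "\<forall>x>0. f x = exp (A + l * x) * x powr k"
proof -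
  define B where "B \<epsilon> = {z \<in> space (L n). z \<in> open_simplex n \<and> W z \<le> \<epsilon>}" for \<epsilon>
  have B_simplex: "z \<in> open_simplex n" "W z \<le> \<epsilon>" if "z \<in> B \<epsilon>" for z \<epsilon>
    using that by (auto simp: B_def)
  have sets_B [measurable]: "B \<epsilon> \<in> sets (L n)" for \<epsilon>
    unfolding B_def by measurable
  interpret caps: shrinking_caps \<sigma> n B
  proof (intro shrinking_caps.intro finite_measure_cone_measure n_pos shrinking_caps_axioms.intro)
    show "B \<epsilon> \<in> sets \<sigma>" for \<epsilon>
      unfolding sets_cone_measure[OF n_pos] by (rule sets_B)
    show "(\<lambda>z. z i) \<in> borel_measurable \<sigma>" if "i \<in> {1..n}" for i
      using coordinate_measurable_L[OF n_pos that] by (simp only: measurable_cong_sets[OF sets_cone_measure[OF n_pos] refl])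
    show "0 < z i" if "z \<in> B \<epsilon>" "i \<in> {1..n}" for z \<epsilon> i
      using B_simplex(1)[OF that(1)] that(2) by (simp add: open_simplex_def orthant_def)
    show "(\<Sum>i=1..n. z i) = real n" if "z \<in> B \<epsilon>" for z \<epsilon>
      using B_simplex(1)[OF that] n_pos by (simp add: open_simplex_def sample_mean_def)
  next
    fix \<delta> :: real assume \<delta>: "0 < \<delta>"
    have "\<bar>z i - 1\<bar> \<le> \<delta>" if "\<epsilon> < \<delta> / c" "z \<in> B \<epsilon>" "i \<in> {1..n}" for \<epsilon> z i
    proof -
      have "c * W z \<le> c * (\<delta> / c)"
        using that c B_simplex(2)[OF that(2)] by (intro mult_left_mono) auto
      then show ?thesis
        using W_lower[OF B_simplex(1)[OF that(2)] that(3)] c by simp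
    qed
    then show "\<forall>\<^sub>F \<epsilon> in at_right 0. \<forall>z\<in>B \<epsilon>. \<forall>i\<in>{1..n}. \<bar>z i - 1\<bar> \<le> \<delta>"
      unfolding eventually_at_right_field using \<delta> c by (intro exI[of _ "\<delta> / c"]) auto
  next
    fix \<epsilon> :: real assume \<epsilon>: "0 < \<epsilon>"
    interpret \<sigma>: finite_measure \<sigma>
      by (rule finite_measure_cone_measure[OF n_pos])
    let ?S = "{z \<in> space (L n). z \<in> open_simplex n \<and> (\<forall>i\<in>{1..n}. \<bar>z i - 1\<bar> \<le> \<epsilon> / C) \<and> (\<exists>i\<in>{1..n}. z i \<noteq> 1)}"
    let ?T = "{z \<in> B \<epsilon>. \<exists>i\<in>{1..n}. z i \<noteq> 1}"
    have "?T = {z \<in> space (L n). z \<in> B \<epsilon> \<and> (\<exists>i\<in>{1..n}. z i \<noteq> 1)}"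
      by (auto simp: B_def)
    also have "\<dots> \<in> sets (L n)"
      by measurable
    finally have T: "?T \<in> sets \<sigma>"
      unfolding sets_cone_measure[OF n_pos] .
    have "?S \<subseteq> ?T"
    proof
      fix z assume z: "z \<in> ?S"
      then have "W z \<le> C * (\<epsilon> / C)"
        using \<epsilon> C by (intro W_upper) auto
      then show "z \<in> ?T" using z C by (auto simp: B_def)
    qed
    then have "emeasure \<sigma> ?S \<le> emeasure \<sigma> ?T"
      using T by (rule emeasure_mono)
    moreover have "0 < emeasure \<sigma> ?S"
      using \<epsilon> C by (intro cone_measure_off_centre n_pos n2) auto
    ultimately have "0 < emeasure \<sigma> ?T" by simp
    then show "0 < measure \<sigma> ?T"
      by (simp add: \<sigma>.emeasure_eq_measure)
  qed
  have ray_cap: "ray_mass {..\<epsilon>} s = ennreal (caps.cap_mean f \<epsilon> s)"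
    if s: "0 < s" and small: "\<And>z i. z \<in> B \<epsilon> \<Longrightarrow> i \<in> {1..n} \<Longrightarrow> \<bar>z i - 1\<bar> \<le> 1/2" for \<epsilon> s
  proof -
    obtain D where D: "\<And>z. z \<in> B \<epsilon> \<Longrightarrow> \<bar>\<Prod>i=1..n. f (s * z i)\<bar> \<le> D"
      by (rule caps.f_bounds_on_cap[OF f_measurable f_pos f_cont, of s s \<epsilon>]) (use s small in auto)
    have nonneg: "0 \<le> indicator (B \<epsilon>) z *\<^sub>R (\<Prod>i=1..n. f (s * z i))" for z
      using f_pos caps.B_pos[of z \<epsilon>] s by (auto simp: indicator_def less_imp_le intro!: prod_nonneg)
    have "ray_mass {..\<epsilon>} s = (\<integral>\<^sup>+z. ennreal (indicator (B \<epsilon>) z *\<^sub>R (\<Prod>i=1..n. f (s * z i))) \<partial>\<sigma>)"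
      unfolding ray_mass_def
    proof (rule nn_integral_cong_AE)
      show "AE z in \<sigma>. (\<Prod>i=1..n. ennreal (f (s * z i))) * indicator {..\<epsilon>} (W z)
        = ennreal (indicator (B \<epsilon>) z *\<^sub>R (\<Prod>i=1..n. f (s * z i)))"
        using AE_cone_measure[OF n_pos] AE_space
      proof eventually_elim
        case (elim z)
        have "0 \<le> f (s * z i)" if "i \<in> {1..n}" for i
          using elim that s f_pos[of "s * z i"] by (simp add: open_simplex_def orthant_def less_imp_le)
        then have "(\<Prod>i=1..n. ennreal (f (s * z i))) = ennreal (\<Prod>i=1..n. f (s * z i))"
          by (intro prod_ennreal) auto
        moreover have "z \<in> B \<epsilon> \<longleftrightarrow> W z \<le> \<epsilon>"
          using elim by (simp add: B_def space_cone_measure[OF n_pos])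
        ultimately show ?case by (simp add: indicator_def)
      qed
    qed
    also have "\<dots> = ennreal (caps.cap_mean f \<epsilon> s)"
      using caps.set_integrable_B[OF caps.prod_f_measurable[OF f_measurable, of s] D] nonneg
      unfolding caps.cap_mean_def set_lebesgue_integral_def set_integrable_def
      by (intro nn_integral_eq_integral) auto
    finally show ?thesis .
  qed
  \<comment> \<open>As a measurability rule the projection matches every goal, and its index stays undetermined.\<close>
  note caps.coordinate_measurable [measurable del]
  define P where "P \<epsilon> = prob {w \<in> space M. W (sample w) \<le> \<epsilon>}" for \<epsilon>
  let ?k = "\<lambda>s. ennreal (real n * s ^ (n - 1))"
  have ray_measurable: "ray_mass V \<in> borel_measurable lborel" if [measurable]: "V \<in> sets borel" for V
  proof -
    have "(\<lambda>(s, z). (\<Prod>i=1..n. ennreal (f (s * z i))) * indicator V (W z)) \<in> borel_measurable (lborel \<Otimes>\<^sub>M \<sigma>)"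
      unfolding split_beta by (intro borel_measurable_times_ennreal borel_measurable_prod_ennreal) measurable
    then show ?thesis
      unfolding ray_mass_def[abs_def] by (rule caps.borel_measurable_nn_integral)
  qed
  have conditional: "AE s in lborel. s \<in> {0<..} \<longrightarrow> ray_mass {..\<epsilon>} s = ennreal (P \<epsilon>) * ray_mass UNIV s" for \<epsilon>
  proof -
    note [measurable] = ray_measurable
    define \<rho> where "\<rho> V s = ?k s * ray_mass V s * indicator {0<..} s" for V and s :: real
    have \<rho> [measurable]: "\<rho> V \<in> borel_measurable lborel" if [measurable]: "V \<in> sets borel" for V
      unfolding \<rho>_def[abs_def] by measurable
    have "AE s in lborel. \<rho> {..\<epsilon>} s = ennreal (P \<epsilon>) * \<rho> UNIV s"
    proof (rule sigma_finite_measure.density_unique2[OF sigma_finite_lborel])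
      fix U :: "real set" assume "U \<in> sets lborel"
      then have U [measurable]: "U \<in> sets borel" by simp
      have "(\<integral>\<^sup>+s. \<rho> {..\<epsilon>} s * indicator U s \<partial>lborel)
        = emeasure M {w \<in> space M. sample_mean n (\<lambda>i. X i w) \<in> U} * ennreal (P \<epsilon>)"
        using indep[unfolded mean_shape_indep_iff, rule_format, OF U, of "{..\<epsilon>}"]
          emeasure_mean_shape[OF U, of "{..\<epsilon>}"]
        by (simp add: \<rho>_def P_def emeasure_eq_measure[symmetric])
      also have "\<dots> = ennreal (P \<epsilon>) * (\<integral>\<^sup>+s. \<rho> UNIV s * indicator U s \<partial>lborel)"
        using emeasure_mean_shape[OF U, of UNIV] by (simp add: \<rho>_def mult.commute)
      also have "\<dots> = (\<integral>\<^sup>+s. ennreal (P \<epsilon>) * \<rho> UNIV s * indicator U s \<partial>lborel)"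
        unfolding mult.assoc by (rule nn_integral_cmult[symmetric]) measurable
      finally show "(\<integral>\<^sup>+s\<in>U. \<rho> {..\<epsilon>} s \<partial>lborel) = (\<integral>\<^sup>+s\<in>U. ennreal (P \<epsilon>) * \<rho> UNIV s \<partial>lborel)" .
    qed measurable
    then show ?thesis
    proof eventually_elim
      case (elim s)
      show ?case
      proof
        assume s: "s \<in> {0<..}"
        have "?k s * ray_mass {..\<epsilon>} s = ?k s * (ennreal (P \<epsilon>) * ray_mass UNIV s)"
          using elim s by (simp add: \<rho>_def mult_ac)
        moreover have "?k s \<noteq> 0" "?k s \<noteq> \<top>"
          using s n_pos by auto
        ultimately show "ray_mass {..\<epsilon>} s = ennreal (P \<epsilon>) * ray_mass UNIV s"
          by (simp add: ennreal_mult_cancel_left)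
      qed
    qed
  qed
  let ?small = "\<lambda>\<epsilon>. \<forall>z\<in>B \<epsilon>. \<forall>i\<in>{1..n}. \<bar>z i - 1\<bar> \<le> 1/2"
  have small: "\<forall>\<^sub>F \<epsilon> in at_right 0. 0 < \<epsilon> \<and> ?small \<epsilon>"
    by (rule caps.eventually_small) simp
  have cap_nonneg: "0 \<le> caps.cap_mean f \<epsilon> s" if "0 < s" for \<epsilon> s
    unfolding caps.cap_mean_def set_lebesgue_integral_def
    using f_pos caps.B_pos[of _ \<epsilon>] that
    by (intro Bochner_Integration.integral_nonneg) (auto simp: indicator_def less_imp_le intro!: prod_nonneg)
  have prop_real: "P \<epsilon>' * caps.cap_mean f \<epsilon> s = P \<epsilon> * caps.cap_mean f \<epsilon>' s"
    if \<epsilon>: "?small \<epsilon>" and \<epsilon>': "?small \<epsilon>'" and s: "0 < s" for \<epsilon> \<epsilon>' s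
  proof (rule continuous_eq_if_AE_eq[of "{0<..}" _ _ s])
    show "continuous_on {0<..} (\<lambda>s. P \<epsilon>' * caps.cap_mean f \<epsilon> s)" "continuous_on {0<..} (\<lambda>s. P \<epsilon> * caps.cap_mean f \<epsilon>' s)"
      using \<epsilon> \<epsilon>' by (intro continuous_intros caps.continuous_cap_mean f_measurable f_pos f_cont; simp)+
    show "AE s in lborel. s \<in> {0<..} \<longrightarrow> P \<epsilon>' * caps.cap_mean f \<epsilon> s = P \<epsilon> * caps.cap_mean f \<epsilon>' s"
      using conditional[of \<epsilon>] conditional[of \<epsilon>']
    proof eventually_elim
      case (elim s)
      show ?case
      proof
        assume s: "s \<in> {0<..}"
        have r: "ray_mass {..\<epsilon>} s = ennreal (caps.cap_mean f \<epsilon> s)" "ray_mass {..\<epsilon>'} s = ennreal (caps.cap_mean f \<epsilon>' s)"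
          using s \<epsilon> \<epsilon>' by (intro ray_cap; simp)+
        have "ennreal (P \<epsilon>') * ennreal (caps.cap_mean f \<epsilon> s) = ennreal (P \<epsilon>) * ennreal (caps.cap_mean f \<epsilon>' s)"
          unfolding r[symmetric] using elim s by (simp add: mult.left_commute)
        then show "P \<epsilon>' * caps.cap_mean f \<epsilon> s = P \<epsilon> * caps.cap_mean f \<epsilon>' s"
          using cap_nonneg[of s] s by (simp add: ennreal_mult[symmetric] P_def)
      qed
    qed
  qed (use s in auto)
  have near1: "\<forall>\<^sub>F \<epsilon> in at_right 0. 0 < caps.cap_mean f \<epsilon> 1"
    using caps.eventually_cap_mean_near[OF f_measurable f_pos f_cont, of 1 "1/2", simplified] small
  proof eventually_elim
    case (elim \<epsilon>)
    have "0 < (f 1 / 2) ^ n * measure \<sigma> (B \<epsilon>)"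
      using f_pos[of 1] caps.measure_B_pos[of \<epsilon>] elim by simp
    with elim show ?case by simp
  qed
  have P_pos: "\<forall>\<^sub>F \<epsilon> in at_right 0. 0 < P \<epsilon>"
    using near1 small
  proof eventually_elim
    case (elim \<epsilon>)
    note \<epsilon> = this
    have "P \<epsilon> \<noteq> 0"
    proof
      assume P0: "P \<epsilon> = 0"
      have "caps.cap_mean f \<epsilon> 1 = 0"
      proof (rule continuous_eq_if_AE_eq[of "{0<..}" "caps.cap_mean f \<epsilon>" "\<lambda>_. 0" 1])
        show "continuous_on {0<..} (caps.cap_mean f \<epsilon>)"
          using elim by (intro caps.continuous_cap_mean f_measurable f_pos f_cont) auto
        show "AE s in lborel. s \<in> {0<..} \<longrightarrow> caps.cap_mean f \<epsilon> s = 0"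
          using conditional[of \<epsilon>]
        proof eventually_elim
          case (elim s)
          show ?case
          proof
            assume s: "s \<in> {0<..}"
            then have "ray_mass {..\<epsilon>} s = ennreal (caps.cap_mean f \<epsilon> s)"
              using \<epsilon> by (intro ray_cap) auto
            then show "caps.cap_mean f \<epsilon> s = 0"
              using elim s cap_nonneg[of s \<epsilon>] by (simp add: P0)
          qed
        qed
      qed auto
      with elim show False by simp
    qed
    then show ?case by (simp add: P_def less_le)
  qed
  have "\<forall>\<^sub>F \<epsilon> in at_right 0. \<forall>\<^sub>F \<epsilon>' in at_right 0. \<forall>s>0.
    caps.cap_mean f \<epsilon> s * caps.cap_mean f \<epsilon>' 1 = caps.cap_mean f \<epsilon>' s * caps.cap_mean f \<epsilon> 1"
    using small P_pos
  proof eventually_elim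
    case (elim \<epsilon>)
    note \<epsilon> = this
    show ?case
      using small P_pos
    proof eventually_elim
      case (elim \<epsilon>')
      show ?case
      proof (intro allI impI)
        fix s :: real assume s: "0 < s"
        have "caps.cap_mean f \<epsilon> s = P \<epsilon> / P \<epsilon>' * caps.cap_mean f \<epsilon>' s"
          "caps.cap_mean f \<epsilon> 1 = P \<epsilon> / P \<epsilon>' * caps.cap_mean f \<epsilon>' 1"
          using prop_real[of \<epsilon> \<epsilon>' s] prop_real[of \<epsilon> \<epsilon>' 1] \<epsilon> elim s by (simp_all add: field_simps)
        then show "caps.cap_mean f \<epsilon> s * caps.cap_mean f \<epsilon>' 1 = caps.cap_mean f \<epsilon>' s * caps.cap_mean f \<epsilon> 1"
          by simp
      qed
    qed
  qed
  then have "\<forall>\<^sub>F \<epsilon> in at_right 0. \<forall>s>0.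
    caps.cap_mean f \<epsilon> s = caps.cap_mean f \<epsilon> 1 / f 1 ^ n * f s ^ n"
    by (rule caps.cap_mean_factorises[OF f_measurable f_pos f_cont, rotated])
  then obtain A l k where "\<forall>x>0. f x = exp (A + l * x) * x powr k"
    by (rule caps.power_exp_if_cap_mean_factorises[OF f_measurable f_pos f_cont, rotated])
  then show thesis by (rule that)
qed

end

section \<open>Characterisation of the gamma distribution\<close>

theorem corollary7:
  fixes M :: "'w measure" and X :: "nat \<Rightarrow> 'w \<Rightarrow> real" and F :: "real measure"
    and f :: "real \<Rightarrow> real" and n :: nat and p q :: real and a :: "nat \<Rightarrow> nat \<Rightarrow> real"
  assumes "prob_space M"
    and "n \<ge> 3"
    and "prob_space.indep_vars M (\<lambda>_. borel) X {1..n}"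
    and "\<And>i. i \<in> {1..n} \<Longrightarrow> distr M borel (X i) = F"
    and "\<And>i. i \<in> {1..n} \<Longrightarrow> AE w in M. 0 < X i w"
    and "f \<in> borel_measurable borel"
    and "\<And>x. 0 \<le> f x"
    and "F = density lborel (\<lambda>x. ennreal (f x))"
    and "\<And>x. 0 < x \<Longrightarrow> 0 < f x"
    and "continuous_on {0<..} f"
    and "p > 0" and "q > 0"
    and "\<And>i j. i \<in> {1..n} \<Longrightarrow> j \<in> {1..n} \<Longrightarrow> 0 \<le> a i j"
    and "a 1 1 > 0" and "a n n > 0"
  shows "prob_space.indep_var M
           borel (\<lambda>w. sample_mean n (\<lambda>i. X i w))
           borel (\<lambda>w. Z_stat n a p q (\<lambda>i. X i w) powr (1 / (p + q)) / sample_mean n (\<lambda>i. X i w))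
         \<longleftrightarrow> gamma_distribution F"
proof -
  interpret prob_space M by fact
  have n: "0 < n" "2 \<le> n" using assms(2) by simp_all
  define W where "W x = Z_stat n a p q x powr (1 / (p + q)) / sample_mean n x" for x
  have W_measurable: "W \<in> borel_measurable (L n)"
  proof -
    note [measurable] = mean_measurable_L[OF n(1)]
    have [measurable]: "(\<lambda>x. Z_stat n a p q x) \<in> borel_measurable (L n)"
      by (rule Z_stat_measurable[of n "\<lambda>x. x"]) (rule coordinate_measurable_L[OF n(1)])
    show ?thesis unfolding W_def by measurable
  qed
  have W_scale: "W (\<lambda>i\<in>{1..n}. s * z i) = W z" if "0 < s" for z s
  proof -
    have "Z_stat n a p q (\<lambda>i\<in>{1..n}. s * z i) = Z_stat n a p q (\<lambda>i. s * z i)"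
      "sample_mean n (\<lambda>i\<in>{1..n}. s * z i) = sample_mean n (\<lambda>i. s * z i)"
      by (intro Z_stat_cong sample_mean_cong; simp)+
    then show ?thesis
      using that assms(11,12) by (simp add: W_def Z_stat_mult sample_mean_mult powr_mult powr_powr)
  qed
  have W_sample: "(\<lambda>w. Z_stat n a p q (\<lambda>i. X i w) powr (1 / (p + q)) / sample_mean n (\<lambda>i. X i w))
    = (\<lambda>w. W (\<lambda>i\<in>{1..n}. X i w))"
  proof
    fix w
    have "Z_stat n a p q (\<lambda>i\<in>{1..n}. X i w) = Z_stat n a p q (\<lambda>i. X i w)"
      "sample_mean n (\<lambda>i\<in>{1..n}. X i w) = sample_mean n (\<lambda>i. X i w)"
      by (intro Z_stat_cong sample_mean_cong; simp)+
    then show "Z_stat n a p q (\<lambda>i. X i w) powr (1 / (p + q)) / sample_mean n (\<lambda>i. X i w) = W (\<lambda>i\<in>{1..n}. X i w)"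
      by (simp add: W_def)
  qed
  have one: "1 \<in> {1..n}" using n by simp
  have X1: "X 1 \<in> borel_measurable M"
    using assms(3) one by (simp add: indep_vars_def)
  have sample: "iid_sample M X n g W"
    if "g \<in> borel_measurable borel" "F = density lborel (\<lambda>x. ennreal (g x))" for g
    by (intro iid_sample.intro iid_sample_axioms.intro prob_space_axioms n(1) assms(3,5) that(1) W_measurable W_scale)
      (use assms(4) that(2) in auto)
  show ?thesis
    unfolding W_sample
  proof
    assume "gamma_distribution F"
    then obtain \<alpha> \<beta> where ab: "0 < \<alpha>" "0 < \<beta>" and F: "F = density lborel (\<lambda>x. ennreal (gamma_density \<alpha> \<beta> x))"
      unfolding gamma_distribution_def by blast
    have "gamma_density \<alpha> \<beta> \<in> borel_measurable borel"
      unfolding gamma_density_def[abs_def] by measurable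
    then interpret S: iid_sample M X n "gamma_density \<alpha> \<beta>" W
      using F by (rule sample)
    define c where "c = 1 / (Gamma \<alpha> * \<beta> powr \<alpha>)"
    have c: "0 < c"
      using ab Gamma_real_pos[OF ab(1)] by (simp add: c_def)
    show S.mean_shape_indep
    proof (rule S.indep_if_power_exp)
      show "gamma_density \<alpha> \<beta> x = exp (ln c + (- 1 / \<beta>) * x) * x powr (\<alpha> - 1)" if "0 < x" for x
        using that c unfolding exp_add by (simp add: gamma_density_def c_def[symmetric] mult_ac)
    qed
  next
    interpret S: iid_sample M X n f W
      using assms(6,8) by (rule sample)
    assume indep: S.mean_shape_indep
    obtain c where c: "0 < c"
      "\<And>x i. i \<in> {1..n} \<Longrightarrow> \<bar>x i - sample_mean n x\<bar> \<le> c * Z_stat n a p q x powr (1 / (p + q))"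
      using spread_le_Z_stat[where a = a, OF n(1) assms(11-15)] by blast
    obtain C where C: "0 < C"
      "\<And>x d. 0 \<le> d \<Longrightarrow> (\<And>i. i \<in> {1..n} \<Longrightarrow> \<bar>x i - sample_mean n x\<bar> \<le> d) \<Longrightarrow>
        Z_stat n a p q x powr (1 / (p + q)) \<le> C * d"
      using Z_stat_le_spread[where a = a, OF n(1) assms(11-15)] by blast
    obtain A l k where "\<forall>x>0. f x = exp (A + l * x) * x powr k"
    proof (rule S.power_exp_if_indep[OF n(2) assms(9,10) _ _ c(1) C(1) indep])
      show "\<bar>z i - 1\<bar> \<le> c * W z" if "z \<in> open_simplex n" "i \<in> {1..n}" for z i
        using c(2)[OF that(2), of z] that(1) by (simp add: W_def open_simplex_def)
      show "W z \<le> C * d" if "z \<in> open_simplex n" "0 \<le> d" "\<And>i. i \<in> {1..n} \<Longrightarrow> \<bar>z i - 1\<bar> \<le> d" for z d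
        using C(2)[OF that(2), of z] that by (simp add: W_def open_simplex_def)
    qed
    moreover have "prob_space F"
      using prob_space_distr[OF X1] unfolding assms(4)[OF one] .
    moreover have "AE x in F. 0 < x"
    proof -
      have "AE x in distr M borel (X 1). 0 < x"
        using assms(5)[OF one] by (subst AE_distr_iff[OF X1]) auto
      then show ?thesis unfolding assms(4)[OF one] .
    qed
    ultimately show "gamma_distribution F"
      using gamma_distribution_if_power_exp[OF assms(6,8)] assms(7) by blast
  qed
qed

end
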